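(* There exists a function $f:\mathbb{R}^2\to\mathbb{R}$ that is locally Lipschitz on $\mathbb{R}^2\setminus\{0\}$ and belongs to $W^{1,p}_{loc}(\mathbb{R}^2)$ for every $1\le p<3$, such that $f$ is stable but its intrinsic graph $\Gamma_f$ is not an intrinsic plane.
   Context: The Heisenberg group $\mathbb{H}$ is $\mathbb{R}^3$ with the group law $(x,y,z)(x',y',z')=\left(x+x',y+y',z+z'+\frac12(xy'-x'y)\right)$. An intrinsic plane is a coset of a two-dimensional Lie subgroup of $\mathbb{H}$. For $f:\omega\to\mathbb{R}$, $\omega\subset\mathbb{R}^2$ (coordinates $(y,t)$), the intrinsic graph of $f$ is $\Gamma_f=\{(0,y,t)(f(y,t),0,0):(y,t)\in\omega\}=\{(f(y,t),y,t-\frac12 yf(y,t)):(y,t)\in\omega\}$. For $\omega$ open and $f\in W^{1,1}_{loc}(\omega)$, set $\nabla^f=\partial_y+f\,\partial_t$, so that $\nabla^f f=\partial_y f+f\partial_t f$, and define the graph area functional $\mathscr{A}_f(E)=\int_E\sqrt{1+(\nabla^f f)^2}\,d\mathcal{L}^2$ for measurable $E\subset\omega$. For $\varphi\in C^\infty_c(\omega)$ define $$I_f(\varphi)=\frac{d}{d\epsilon}\Big|_{\epsilon=0}\mathscr{A}_{f+\epsilon\varphi}(\mathrm{spt}(\varphi)),\qquad II_f(\varphi)=\frac{d^2}{d\epsilon^2}\Big|_{\epsilon=0}\mathscr{A}_{f+\epsilon\varphi}(\mathrm{spt}(\varphi)).$$ $f$ is stationary (on $\omega$) if $I_f(\varphi)=0$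 for all $\varphi\in C^\infty_c(\omega)$; $f$ is stable if it is stationary and $II_f(\varphi)\ge 0$ for all $\varphi\in C^\infty_c(\omega)$. Here $\omega=\mathbb{R}^2$. *)

theory Defs
  imports "HOL-Analysis.Analysis" "HOL-Algebra.Coset"
begin

section \<open>The Heisenberg group\<close>

definition heisenberg :: "(real \<times> real \<times> real) monoid" where
  "heisenberg =
    \<lparr>carrier = UNIV,
     mult = (\<lambda>(x, y, z) (x', y', z'). (x + x', y + y', z + z' + (x * y' - x' * y) / 2)),
     one = (0, 0, 0)\<rparr>"

lemma group_heisenberg: "group heisenberg"
proof (rule groupI)
  fix p assume "p \<in> carrier heisenberg"
  show "\<exists>q\<in>carrier heisenberg. q \<otimes>\<^bsub>heisenberg\<^esub> p = \<one>\<^bsub>heisenberg\<^esub>"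
    by (rule bexI[of _ "- p"]) (auto simp: heisenberg_def split: prod.splits)
qed (auto simp: heisenberg_def field_simps split: prod.splits)


section \<open>Smooth functions and surfaces\<close>

text \<open>Meant for open \<open>S\<close>: a function is of class $C^{k+1}$ if it is differentiable and its partial
  derivatives are of class $C^k$.\<close>

primrec Ck_on :: "nat \<Rightarrow> 'a::euclidean_space set \<Rightarrow> ('a \<Rightarrow> 'b::real_normed_vector) \<Rightarrow> bool" where
  "Ck_on 0 S f \<longleftrightarrow> continuous_on S f"
| "Ck_on (Suc k) S f \<longleftrightarrow>
     (\<forall>x\<in>S. f differentiable (at x)) \<and>
     (\<forall>e\<in>Basis. Ck_on k S (\<lambda>x. frechet_derivative f (at x) e))"

definition smooth_on :: "'a::euclidean_space set \<Rightarrow> ('a \<Rightarrow> 'b::real_normed_vector) \<Rightarrow> bool" where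
  "smooth_on S f \<longleftrightarrow> (\<forall>k. Ck_on k S f)"

text \<open>Embedded two-dimensional smooth submanifolds of $\mathbb{R}^3$, described by local
  parametrizations that are immersions and homeomorphisms onto relatively open pieces.\<close>

definition smooth_surface :: "(real \<times> real \<times> real) set \<Rightarrow> bool" where
  "smooth_surface M \<longleftrightarrow>
     (\<forall>p\<in>M. \<exists>U (V :: (real \<times> real) set) \<psi> \<theta>.
        open U \<and> p \<in> U \<and> open V \<and> smooth_on V \<psi> \<and>
        homeomorphism V (M \<inter> U) \<psi> \<theta> \<and>
        (\<forall>v\<in>V. inj (frechet_derivative \<psi> (at v))))"

definition lie_subgroup_2 :: "(real \<times> real \<times> real) set \<Rightarrow> bool" where
  "lie_subgroup_2 W \<longleftrightarrow> subgroup W heisenberg \<and> smooth_surface W"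

text \<open>Right cosets give the same family of sets, since \<open>W p = p (p\<inverse> W p)\<close> and conjugates of
  Lie subgroups are Lie subgroups of the same dimension.\<close>

definition intrinsic_plane :: "(real \<times> real \<times> real) set \<Rightarrow> bool" where
  "intrinsic_plane P \<longleftrightarrow> (\<exists>W p. lie_subgroup_2 W \<and> P = p <#\<^bsub>heisenberg\<^esub> W)"

text \<open>Here and below, functions on \<open>\<omega>\<close> are total functions whose values outside \<open>\<omega>\<close> are
  irrelevant.  The intrinsic graph depends on the pointwise values of \<open>f\<close>, whereas Sobolev functions,
  stationarity and stability only depend on the class of \<open>f\<close> up to null sets; a statement
  about the graph of a Sobolev function has to take all representatives into account.\<close>

definition intrinsic_graph :: "(real \<times> real) set \<Rightarrow> (real \<times> real \<Rightarrow> real) \<Rightarrow> (real \<times> real \<times> real) set" where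
  "intrinsic_graph \<omega> f = {(0, y, t) \<otimes>\<^bsub>heisenberg\<^esub> (f (y, t), 0, 0) | y t. (y, t) \<in> \<omega>}"

lemma intrinsic_graph_eq:
  "intrinsic_graph \<omega> f = {(f (y, t), y, t - y * f (y, t) / 2) | y t. (y, t) \<in> \<omega>}"
  by (simp add: intrinsic_graph_def heisenberg_def mult.commute)


section \<open>Local Lipschitz and Sobolev regularity\<close>

definition locally_lipschitz_on :: "'a::metric_space set \<Rightarrow> ('a \<Rightarrow> 'b::metric_space) \<Rightarrow> bool" where
  "locally_lipschitz_on S f \<longleftrightarrow> (\<forall>x\<in>S. \<exists>u>0. \<exists>L. L-lipschitz_on (cball x u \<inter> S) f)"

definition spt :: "('a::topological_space \<Rightarrow> real) \<Rightarrow> 'a set" where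
  "spt \<phi> = closure {x. \<phi> x \<noteq> 0}"

text \<open>Elements of $C^\infty_c(\omega)$, extended by zero to the whole space.\<close>

definition test_functions :: "'a::euclidean_space set \<Rightarrow> ('a \<Rightarrow> real) set" where
  "test_functions \<omega> = {\<phi>. smooth_on UNIV \<phi> \<and> compact (spt \<phi>) \<and> spt \<phi> \<subseteq> \<omega>}"

definition Lp_loc :: "'a::euclidean_space set \<Rightarrow> real \<Rightarrow> ('a \<Rightarrow> real) set" where
  "Lp_loc \<omega> p =
     {f. f \<in> borel_measurable (lebesgue_on \<omega>) \<and>
         (\<forall>K. compact K \<and> K \<subseteq> \<omega> \<longrightarrow> set_integrable lebesgue K (\<lambda>x. \<bar>f x\<bar> powr p))}"

definition has_weak_partial ::
    "'a::euclidean_space set \<Rightarrow> 'a \<Rightarrow> ('a \<Rightarrow> real) \<Rightarrow> ('a \<Rightarrow> real) \<Rightarrow> bool" where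
  "has_weak_partial \<omega> e f g \<longleftrightarrow>
     f \<in> Lp_loc \<omega> 1 \<and> g \<in> Lp_loc \<omega> 1 \<and>
     (\<forall>\<phi>\<in>test_functions \<omega>.
        (LINT x:\<omega>|lebesgue. f x * frechet_derivative \<phi> (at x) e) =
        - (LINT x:\<omega>|lebesgue. g x * \<phi> x))"

text \<open>A representative of the weak partial derivative in direction \<open>e\<close>, which is unique up to
  null sets.\<close>

definition weak_partial :: "'a::euclidean_space set \<Rightarrow> 'a \<Rightarrow> ('a \<Rightarrow> real) \<Rightarrow> 'a \<Rightarrow> real" where
  "weak_partial \<omega> e f = (SOME g. has_weak_partial \<omega> e f g)"

definition W1p_loc :: "'a::euclidean_space set \<Rightarrow> real \<Rightarrow> ('a \<Rightarrow> real) set" where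
  "W1p_loc \<omega> p =
     {f. f \<in> Lp_loc \<omega> p \<and> (\<forall>e\<in>Basis. \<exists>g. has_weak_partial \<omega> e f g \<and> g \<in> Lp_loc \<omega> p)}"


section \<open>The area functional and its variations\<close>

definition intrinsic_gradient ::
    "(real \<times> real) set \<Rightarrow> (real \<times> real \<Rightarrow> real) \<Rightarrow> real \<times> real \<Rightarrow> real" where
  "intrinsic_gradient \<omega> f x = weak_partial \<omega> (1, 0) f x + f x * weak_partial \<omega> (0, 1) f x"

definition graph_area ::
    "(real \<times> real) set \<Rightarrow> (real \<times> real \<Rightarrow> real) \<Rightarrow> (real \<times> real) set \<Rightarrow> ennreal" where
  "graph_area \<omega> f E = (\<integral>\<^sup>+x\<in>E. ennreal (sqrt (1 + (intrinsic_gradient \<omega> f x)\<^sup>2)) \<partial>lebesgue)"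

definition perturbed_area ::
    "(real \<times> real) set \<Rightarrow> (real \<times> real \<Rightarrow> real) \<Rightarrow> (real \<times> real \<Rightarrow> real) \<Rightarrow> real \<Rightarrow> ennreal" where
  "perturbed_area \<omega> f \<phi> \<epsilon> = graph_area \<omega> (\<lambda>x. f x + \<epsilon> * \<phi> x) (spt \<phi>)"

text \<open>The variations are relations, so that \<open>I\<^sub>f(\<phi>) = v\<close> and \<open>II\<^sub>f(\<phi>) = v\<close> include the finiteness
  of the area for small \<open>\<epsilon>\<close> and the existence of the derivatives.\<close>

definition has_first_variation ::
    "(real \<times> real) set \<Rightarrow> (real \<times> real \<Rightarrow> real) \<Rightarrow> (real \<times> real \<Rightarrow> real) \<Rightarrow> real \<Rightarrow> bool" where
  "has_first_variation \<omega> f \<phi> v \<longleftrightarrow>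
     (\<forall>\<^sub>F \<epsilon> in nhds 0. perturbed_area \<omega> f \<phi> \<epsilon> < \<infinity>) \<and>
     ((\<lambda>\<epsilon>. enn2real (perturbed_area \<omega> f \<phi> \<epsilon>)) has_real_derivative v) (at 0)"

definition has_second_variation ::
    "(real \<times> real) set \<Rightarrow> (real \<times> real \<Rightarrow> real) \<Rightarrow> (real \<times> real \<Rightarrow> real) \<Rightarrow> real \<Rightarrow> bool" where
  "has_second_variation \<omega> f \<phi> v \<longleftrightarrow>
     (\<exists>A'. (\<forall>\<^sub>F \<epsilon> in nhds 0. perturbed_area \<omega> f \<phi> \<epsilon> < \<infinity> \<and>
              ((\<lambda>\<delta>. enn2real (perturbed_area \<omega> f \<phi> \<delta>)) has_real_derivative A' \<epsilon>) (at \<epsilon>)) \<and>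
           (A' has_real_derivative v) (at 0))"

definition stationary :: "(real \<times> real) set \<Rightarrow> (real \<times> real \<Rightarrow> real) \<Rightarrow> bool" where
  "stationary \<omega> f \<longleftrightarrow>
     f \<in> W1p_loc \<omega> 1 \<and> (\<forall>\<phi>\<in>test_functions \<omega>. has_first_variation \<omega> f \<phi> 0)"

definition stable :: "(real \<times> real) set \<Rightarrow> (real \<times> real \<Rightarrow> real) \<Rightarrow> bool" where
  "stable \<omega> f \<longleftrightarrow>
     stationary \<omega> f \<and> (\<forall>\<phi>\<in>test_functions \<omega>. \<exists>v\<ge>0. has_second_variation \<omega> f \<phi> v)"

end

theory Submission imports Defs begin

text \<open>The function is \<open>f(y, t) = y w(y, t)\<close>, where \<open>w\<close> is \<open>2t / y\<^sup>2\<close> clamped to \<open>[0, 2]\<close>.  Its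
  characteristics, the integral curves of \<open>\<partial>\<^sub>y + f \<partial>\<^sub>t\<close>, are the lines \<open>t = c \<le> 0\<close>, the parabolas
  \<open>t = y\<^sup>2 + c\<close> with \<open>c \<ge> 0\<close>, and the fan of parabolas \<open>t = \<sigma>y\<^sup>2\<close> with \<open>0 < \<sigma> < 1\<close> through the origin.
  The intrinsic gradient of \<open>f\<close> is \<open>w\<close>, which is constant along characteristics; this gives
  stationarity.  Since \<open>\<partial>\<^sub>t f = 2 / y\<close> on the fan, which has width \<open>y\<^sup>2\<close>, the power \<open>\<bar>\<partial>\<^sub>t f\<bar>\<^sup>p\<close> is locally
  integrable exactly for \<open>p < 3\<close>.

  With \<open>X = \<partial>\<^sub>y + f \<partial>\<^sub>t\<close>, \<open>h = w / \<surd>(1 + w\<^sup>2)\<close> and \<open>\<rho> = (1 + w\<^sup>2) powr (- 3 / 2)\<close>, the second variation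
  is the integral of \<open>\<rho> (X\<phi> + \<phi> \<partial>\<^sub>t f)\<^sup>2 + 2 h \<phi> \<partial>\<^sub>t\<phi>\<close>.  Integrating the last term by parts and
  subtracting the Jacobian of \<open>(y \<phi>\<^sup>2, h)\<close>, whose integral vanishes, leaves \<open>\<rho> (X\<phi>)\<^sup>2\<close>,
  on the fan and off it.  Finally, \<open>f\<close> is zero for \<open>t < 0\<close>, so the graph could only be the
  plane \<open>x = 0\<close>.\<close>

section \<open>Test functions\<close>

text \<open>Geometrically the graph consists of the half \<open>z \<le> 0\<close> of the vertical
  plane \<open>x = 0\<close>, the half \<open>z \<ge> 0\<close> of the vertical plane
  \<open>x = 2 y\<close>, and a double sector of the horizontal plane \<open>z = 0\<close> that
  joins them: on the fan \<open>f = 2 t / y\<close>, so the third coordinate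
  \<open>t - y f / 2\<close> vanishes. Taking 2 as the largest slope makes the fan exactly
  \<open>0 < t < y\<^sup>2\<close>.

  The obstacle is the origin, where the slope has no limit and \<open>\<partial>\<^sub>t f\<close>
  is unbounded. Differentiating the area twice under the integral requires
  \<open>(\<partial>\<^sub>t f)\<^sup>2\<close> to be locally integrable, which is the case
  \<open>p = 2\<close>. Weak derivatives do not see the origin, because only the slices
  \<open>y = 0\<close> and \<open>t = 0\<close> pass through it.

  The factor \<open>y\<close> in the Jacobian comes from \<open>X y = 1\<close>. On the fan
  \<open>\<partial>\<^sub>t f = 2 / y\<close> and
  \<open>\<partial>\<^sub>t w = 2 / y\<^sup>2\<close>, so subtracting
  \<open>\<partial>\<^sub>t w X(y \<phi>\<^sup>2)\<close> removes the cross term of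
  \<open>(X\<phi> + 2 \<phi> / y)\<^sup>2\<close> and the part of
  \<open>4 \<phi>\<^sup>2 / y\<^sup>2\<close> that the integration by parts leaves. No change of
  variables to characteristics is needed.\<close>

lemma frechet_derivative_eqI:
  "(f has_derivative f') (at x) \<Longrightarrow> frechet_derivative f (at x) e = f' e"
  using frechet_derivative_at by metis

lemma Ck_on_mono_Suc: "Ck_on (Suc k) S f \<Longrightarrow> Ck_on k S f"
proof (induction k arbitrary: f)
  case 0
  then show ?case
    by (auto intro!: continuous_at_imp_continuous_on differentiable_imp_continuous_within)
qed auto

lemma Ck_on_const: "Ck_on k S (\<lambda>_. c)"
proof (induction k arbitrary: c)
  case (Suc k)
  have "frechet_derivative (\<lambda>_. c) (at x) = (\<lambda>_. 0)" for x :: 'a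
    by (rule frechet_derivative_const)
  then show ?case using Suc by simp
qed auto

lemma Ck_on_add:
  "Ck_on k UNIV f \<Longrightarrow> Ck_on k UNIV g \<Longrightarrow> Ck_on k UNIV (\<lambda>x. f x + g x)"
proof (induction k arbitrary: f g)
  case 0
  then show ?case by (simp add: continuous_on_add)
next
  case (Suc k)
  have "frechet_derivative (\<lambda>x. f x + g x) (at x) e
      = frechet_derivative f (at x) e + frechet_derivative g (at x) e" for x e
    using Suc.prems
    by (intro frechet_derivative_eqI has_derivative_add) (auto simp: frechet_derivative_works)
  with Suc show ?case by auto
qed

lemma Ck_on_mult:
  fixes f g :: "'a::euclidean_space \<Rightarrow> real"
  shows "Ck_on k UNIV f \<Longrightarrow> Ck_on k UNIV g \<Longrightarrow> Ck_on k UNIV (\<lambda>x. f x * g x)"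
proof (induction k arbitrary: f g)
  case 0
  then show ?case by (simp add: continuous_on_mult)
next
  case (Suc k)
  have "frechet_derivative (\<lambda>x. f x * g x) (at x) e
      = f x * frechet_derivative g (at x) e + frechet_derivative f (at x) e * g x" for x e
    using Suc.prems
    by (intro frechet_derivative_eqI has_derivative_mult) (auto simp: frechet_derivative_works)
  with Suc Ck_on_mono_Suc[of k UNIV f] Ck_on_mono_Suc[of k UNIV g] show ?case
    by (auto intro!: Ck_on_add)
qed

lemma Ck_on_prod:
  fixes f :: "'i \<Rightarrow> 'a::euclidean_space \<Rightarrow> real"
  assumes "\<And>i. i \<in> I \<Longrightarrow> Ck_on k UNIV (f i)"
  shows "Ck_on k UNIV (\<lambda>x. \<Prod>i\<in>I. f i x)"
  using assms by (induction I rule: infinite_finite_induct) (auto intro: Ck_on_mult Ck_on_const)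

section \<open>Smooth functions that are flat at the origin\<close>

definition flat :: "nat \<Rightarrow> real \<Rightarrow> real" where
  "flat k x = (if x \<le> 0 then 0 else exp (- 1 / x) / x ^ k)"

lemma flat_tendsto_0: "(flat k \<longlongrightarrow> 0) (at 0)"
proof -
  have "((\<lambda>x. inverse x ^ k / exp (inverse x)) \<longlongrightarrow> (0::real)) (at_right 0)"
    by (rule filterlim_compose[OF tendsto_power_div_exp_0 filterlim_inverse_at_top_right])
  then have "(flat k \<longlongrightarrow> 0) (at_right 0)"
    by (rule Lim_transform_eventually)
      (auto simp: flat_def eventually_at_filter exp_minus field_simps)
  moreover have "(flat k \<longlongrightarrow> 0) (at_left 0)"
    by (rule tendsto_eventually) (auto simp: flat_def eventually_at_filter)
  ultimately show ?thesis by (rule filterlim_split_at[rotated])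
qed

text \<open>The power of \<open>x\<close> is carried as a parameter because the span of the
  functions \<open>flat k\<close> is closed under differentiation, so smoothness of
  \<open>flat 0\<close> becomes an induction on the order.\<close>

lemma flat_has_derivative:
  "(flat k has_real_derivative (flat (k + 2) x - real k * flat (k + 1) x)) (at x)"
proof (cases x "0::real" rule: linorder_cases)
  case less
  have "((\<lambda>_. 0) has_real_derivative 0) (at x)" by simp
  then show ?thesis
    by (rule has_field_derivative_transform_within_open[where S="{..<0}", THEN DERIV_cong])
       (use less in \<open>auto simp: flat_def\<close>)
next
  case equal
  \<comment> \<open>The difference quotient of \<open>flat k\<close> at 0 is
    \<open>flat (k + 1)\<close>, which tends to 0 by the preceding limit.\<close>
  have "((\<lambda>h. (flat k (0 + h) - flat k 0) / h) \<longlongrightarrow> 0) (at 0)"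
    by (rule Lim_transform_eventually[OF flat_tendsto_0[of "k + 1"]])
      (auto simp: flat_def eventually_at_filter)
  then show ?thesis using equal by (simp add: DERIV_def) (simp add: flat_def)
next
  case greater
  \<comment> \<open>For \<open>k = 0\<close> the exponent \<open>k - 1\<close> is truncated to 0,
    which is harmless because of the factor \<open>real k\<close>.\<close>
  have "((\<lambda>x. exp (- 1 / x) / x ^ k) has_real_derivative
      (exp (- 1 / x) * (1 / (x * x)) * x ^ k - exp (- 1 / x) * (real k * x ^ (k - 1))) / (x ^ k * x ^ k)) (at x)"
    using greater by (auto intro!: derivative_eq_intros)
  also have "(exp (- 1 / x) * (1 / (x * x)) * x ^ k - exp (- 1 / x) * (real k * x ^ (k - 1))) / (x ^ k * x ^ k)
      = flat (k + 2) x - real k * flat (k + 1) x"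
    using greater by (cases k) (simp_all add: flat_def field_simps)
  finally have "((\<lambda>x. exp (- 1 / x) / x ^ k) has_real_derivative
      (flat (k + 2) x - real k * flat (k + 1) x)) (at x)" .
  then show ?thesis
    by (rule has_field_derivative_transform_within_open[where S="{0<..}"])
       (use greater in \<open>auto simp: flat_def\<close>)
qed

text \<open>The derivative \<open>l'\<close> is the same at every point, so the chain rule
  contributes only the constant \<open>l' e\<close>. Differentiation raises the index of
  \<open>flat\<close>, hence the induction keeps \<open>k\<close> arbitrary.\<close>

lemma Ck_on_flat_affine:
  fixes l :: "'a::euclidean_space \<Rightarrow> real"
  assumes l: "\<And>x. (l has_derivative l') (at x)"
  shows "Ck_on n UNIV (\<lambda>x. flat k (l x))"
proof (induction n arbitrary: k)
  case 0
  have "(flat k has_derivative (*) (flat (k + 2) y - real k * flat (k + 1) y)) (at y)" for y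
    using flat_has_derivative by (simp add: has_field_derivative_def)
  then have "((\<lambda>x. flat k (l x)) has_derivative
      (\<lambda>e. (flat (k + 2) (l x) - real k * flat (k + 1) (l x)) * l' e)) (at x)" for x
    by (rule has_derivative_compose[OF l])
  then show ?case
    by (auto intro!: continuous_at_imp_continuous_on has_derivative_continuous)
next
  case (Suc n)
  have "(flat k has_derivative (*) (flat (k + 2) y - real k * flat (k + 1) y)) (at y)" for y
    using flat_has_derivative by (simp add: has_field_derivative_def)
  then have d: "((\<lambda>x. flat k (l x)) has_derivative
      (\<lambda>e. (flat (k + 2) (l x) - real k * flat (k + 1) (l x)) * l' e)) (at x)" for x
    by (rule has_derivative_compose[OF l])
  have "frechet_derivative (\<lambda>x. flat k (l x)) (at x) e =
      flat (k + 2) (l x) * l' e + (- real k * l' e) * flat (k + 1) (l x)" for x e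
    by (subst frechet_derivative_eqI[OF d]) (simp add: algebra_simps)
  moreover have "Ck_on n UNIV (\<lambda>x. flat (k + 2) (l x) * l' e + (- real k * l' e) * flat (k + 1) (l x))" for e
    by (intro Ck_on_add Ck_on_mult Suc Ck_on_const)
  ultimately show ?case using differentiableI[OF d] by simp
qed

section \<open>Bumps filling an open box\<close>

definition box_bump :: "'a::euclidean_space \<Rightarrow> 'a \<Rightarrow> nat \<Rightarrow> 'a \<Rightarrow> real" where
  "box_bump a b n x = (\<Prod>i\<in>Basis. flat 0 (real n * ((x - a) \<bullet> i)) * flat 0 (real n * ((b - x) \<bullet> i)))"

lemma flat_0_bounds: "0 \<le> flat 0 x" "flat 0 x \<le> 1"
  by (auto simp: flat_def)

lemma box_bump_bounds: "0 \<le> box_bump a b n x" "box_bump a b n x \<le> 1"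
  unfolding box_bump_def
  by (intro prod_nonneg prod_le_1 ballI conjI mult_nonneg_nonneg mult_le_one flat_0_bounds)+

lemma box_bump_outside:
  assumes "x \<notin> box a b"
  shows "box_bump a b n x = 0"
proof -
  obtain i where i: "i \<in> Basis" "x \<bullet> i \<le> a \<bullet> i \<or> b \<bullet> i \<le> x \<bullet> i"
    using assms by (force simp: mem_box not_less)
  then have "flat 0 (real n * ((x - a) \<bullet> i)) * flat 0 (real n * ((b - x) \<bullet> i)) = 0"
    by (auto simp: flat_def inner_diff_left mult_le_0_iff)
  with i(1) show ?thesis
    unfolding box_bump_def by (intro prod_zero bexI) auto
qed

lemma box_bump_test: "box_bump a b n \<in> test_functions UNIV"
proof -
  have "Ck_on k UNIV (box_bump a b n)" for k
    unfolding box_bump_def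
    by (intro Ck_on_prod Ck_on_mult Ck_on_flat_affine) (auto intro!: derivative_eq_intros)
  moreover have "closure {x. box_bump a b n x \<noteq> 0} \<subseteq> cbox a b"
    using box_bump_outside[of _ a b n] box_subset_cbox[of a b]
    by (intro closure_minimal closed_cbox subsetI) (metis (mono_tags, lifting) mem_Collect_eq subset_iff)
  then have "compact (spt (box_bump a b n))"
    unfolding spt_def by (meson bounded_cbox bounded_subset closed_closure compact_eq_bounded_closed)
  ultimately show ?thesis by (simp add: test_functions_def smooth_on_def)
qed

text \<open>The scaling \<open>n\<close> acts inside \<open>flat 0\<close>: for \<open>c > 0\<close>
  the value \<open>exp (- 1 / (n c))\<close> tends to 1, while outside the box some factor is always
  0. This gives approximation of indicators without convolutions.\<close>

lemma box_bump_tendsto: "(\<lambda>n. box_bump a b n x) \<longlonglongrightarrow> indicator (box a b) x"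
proof (cases "x \<in> box a b")
  case True
  have *: "(\<lambda>n. flat 0 (real n * c)) \<longlonglongrightarrow> 1" if "c > 0" for c :: real
  proof -
    have "(\<lambda>n. exp (- inverse c * inverse (real n))) \<longlonglongrightarrow> exp (- inverse c * 0)"
      by (intro tendsto_intros lim_inverse_n)
    moreover have "\<forall>\<^sub>F n in sequentially. exp (- inverse c * inverse (real n)) = flat 0 (real n * c)"
      using eventually_gt_at_top[of 0] by eventually_elim (use that in \<open>auto simp: flat_def not_le field_simps mult_le_0_iff\<close>)
    ultimately show ?thesis by (simp add: Lim_transform_eventually)
  qed
  have "(\<lambda>n. box_bump a b n x) \<longlonglongrightarrow> (\<Prod>i\<in>(Basis::'a set). 1 * 1)"
    unfolding box_bump_def
    by (intro tendsto_prod tendsto_mult *) (use True in \<open>auto simp: mem_box inner_diff_left\<close>)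
  then show ?thesis using True by simp
qed (simp add: box_bump_outside)

section \<open>The fundamental lemma of the calculus of variations\<close>

lemma test_function_continuous: "\<phi> \<in> test_functions \<omega> \<Longrightarrow> continuous_on UNIV \<phi>"
  unfolding test_functions_def smooth_on_def using Ck_on.simps(1) by blast

lemma test_function_differentiable: "\<phi> \<in> test_functions \<omega> \<Longrightarrow> \<phi> differentiable (at x)"
  unfolding test_functions_def smooth_on_def using Ck_on.simps(2)[of 0 UNIV \<phi>] by blast

lemma test_function_has_derivative:
  "\<phi> \<in> test_functions \<omega> \<Longrightarrow> (\<phi> has_derivative frechet_derivative \<phi> (at x)) (at x)"
  by (rule frechet_derivative_works[THEN iffD1, OF test_function_differentiable])

lemma test_function_compact_spt: "\<phi> \<in> test_functions \<omega> \<Longrightarrow> compact (spt \<phi>)"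
  by (simp add: test_functions_def)

lemma not_in_spt: "x \<notin> spt \<phi> \<Longrightarrow> \<phi> x = 0"
  using subsetD[OF closure_subset, of x "{x. \<phi> x \<noteq> 0}"] unfolding spt_def mem_Collect_eq by argo

lemma test_function_partial_outside:
  assumes "x \<notin> spt \<phi>"
  shows "frechet_derivative \<phi> (at x) e = 0"
proof -
  have "((\<lambda>_. 0) has_derivative (\<lambda>_. 0)) (at x)" by simp
  then have "(\<phi> has_derivative (\<lambda>_. 0)) (at x)"
  proof (rule has_derivative_transform_within_open)
    show "open (- spt \<phi>)" by (simp add: spt_def open_Compl)
    show "x \<in> - spt \<phi>" using assms by simp
    show "0 = \<phi> y" if "y \<in> - spt \<phi>" for y using that not_in_spt[of y \<phi>] by simp
  qed
  then show ?thesis by (rule frechet_derivative_eqI)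
qed

lemma test_function_partial:
  assumes "\<phi> \<in> test_functions \<omega>" "e \<in> Basis"
  shows "(\<lambda>x. frechet_derivative \<phi> (at x) e) \<in> test_functions \<omega>"
proof -
  have "Ck_on (Suc k) UNIV \<phi>" for k
    using assms(1) unfolding test_functions_def smooth_on_def by blast
  then have "smooth_on UNIV (\<lambda>x. frechet_derivative \<phi> (at x) e)"
    using assms(2) by (simp add: smooth_on_def)
  moreover have sub: "spt (\<lambda>x. frechet_derivative \<phi> (at x) e) \<subseteq> spt \<phi>"
    unfolding spt_def[of "\<lambda>x. frechet_derivative \<phi> (at x) e"]
    using test_function_partial_outside[of _ \<phi> e]
    by (intro closure_minimal subsetI) (blast, simp add: spt_def)
  moreover have "compact (spt (\<lambda>x. frechet_derivative \<phi> (at x) e))"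
    using sub test_function_compact_spt[OF assms(1)]
    by (metis bounded_subset closed_closure compact_eq_bounded_closed spt_def)
  ultimately show ?thesis using assms(1) by (auto simp: test_functions_def)
qed

lemma test_function_bounded:
  assumes "\<phi> \<in> test_functions \<omega>"
  obtains C where "C > 0" "\<And>x. \<bar>\<phi> x\<bar> \<le> C"
proof -
  have "bounded (\<phi> ` spt \<phi>)"
    using assms
    by (intro compact_imp_bounded compact_continuous_image test_function_compact_spt
        continuous_on_subset[OF test_function_continuous subset_UNIV])
  then obtain C where "C > 0" "\<And>x. x \<in> spt \<phi> \<Longrightarrow> \<bar>\<phi> x\<bar> \<le> C"
    unfolding bounded_pos by auto
  moreover have "\<bar>\<phi> x\<bar> \<le> C" if "x \<notin> spt \<phi>" for x
    using not_in_spt[OF that] \<open>C > 0\<close> by simp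
  ultimately show ?thesis using that by blast
qed

lemma test_function_borel [measurable]: "\<phi> \<in> test_functions \<omega> \<Longrightarrow> \<phi> \<in> borel_measurable borel"
  by (intro borel_measurable_continuous_onI test_function_continuous)

lemma Lp_loc_measurable: "g \<in> Lp_loc UNIV p \<Longrightarrow> g \<in> borel_measurable lebesgue"
  by (simp add: Lp_loc_def lebesgue_on_UNIV_eq)

lemma Lp_loc_1_iff:
  "g \<in> Lp_loc UNIV 1 \<longleftrightarrow>
    g \<in> borel_measurable lebesgue \<and> (\<forall>K. compact K \<longrightarrow> set_integrable lebesgue K g)"
proof -
  have "set_integrable lebesgue K (\<lambda>x. \<bar>g x\<bar> powr 1) = set_integrable lebesgue K g"
    if "compact K" "g \<in> borel_measurable lebesgue" for K
  proof -
    have "K \<in> sets lebesgue" using that(1) lmeasurable_compact fmeasurableD by blast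
    then have "(\<lambda>x. indicator K x *\<^sub>R g x) \<in> borel_measurable lebesgue"
      using that(2) by (intro borel_measurable_scaleR) auto
    moreover have "(\<lambda>x. indicator K x *\<^sub>R (\<bar>g x\<bar> powr 1)) = (\<lambda>x. \<bar>indicator K x *\<^sub>R g x\<bar>)"
      by (auto split: split_indicator)
    ultimately show ?thesis
      using integrable_abs_iff unfolding set_integrable_def by metis
  qed
  then show ?thesis by (auto simp: Lp_loc_def lebesgue_on_UNIV_eq)
qed

lemma integrable_Lp_loc_mult_test:
  assumes g: "g \<in> Lp_loc UNIV 1" and \<phi>: "\<phi> \<in> test_functions \<omega>"
  shows "integrable lebesgue (\<lambda>x. g x * \<phi> x)"
proof -
  obtain C where C: "\<And>x. \<bar>\<phi> x\<bar> \<le> C" using test_function_bounded[OF \<phi>] by metis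
  have "integrable lebesgue (\<lambda>x. C * (indicator (spt \<phi>) x *\<^sub>R g x))"
    using g test_function_compact_spt[OF \<phi>] by (auto simp: Lp_loc_1_iff set_integrable_def)
  then show ?thesis
  proof (rule Bochner_Integration.integrable_bound)
    have "\<phi> \<in> borel_measurable lebesgue"
      using test_function_borel[OF \<phi>] by (intro measurable_completion) simp
    then show "(\<lambda>x. g x * \<phi> x) \<in> borel_measurable lebesgue"
      using Lp_loc_measurable[OF g] by (intro borel_measurable_times)
    have "\<bar>g x * \<phi> x\<bar> \<le> \<bar>C * (indicator (spt \<phi>) x *\<^sub>R g x)\<bar>" for x
    proof (cases "x \<in> spt \<phi>")
      case True
      have "\<bar>g x\<bar> * \<bar>\<phi> x\<bar> \<le> \<bar>g x\<bar> * \<bar>C\<bar>"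
        using C[of x] by (intro mult_left_mono) auto
      then show ?thesis using True by (simp add: abs_mult mult.commute)
    qed (simp add: not_in_spt)
    then show "AE x in lebesgue. norm (g x * \<phi> x) \<le> norm (C * (indicator (spt \<phi>) x *\<^sub>R g x))"
      by simp
  qed
qed

text \<open>The positive and negative parts of \<open>g\<close> are densities of two measures that
  agree on open boxes, an intersection-stable generator of the Borel sets. So the measures agree,
  and so do the densities almost everywhere. Since \<open>ennreal\<close> sends negative numbers to
  0, \<open>ennreal (g x) = ennreal (- g x)\<close> forces \<open>g x = 0\<close>.\<close>

lemma AE_zero_if_box_integrals_zero:
  fixes g :: "'a::euclidean_space \<Rightarrow> real"
  assumes [measurable]: "g \<in> borel_measurable borel"
    and int: "\<And>a b. set_integrable lborel (box a b) g"
    and zero: "\<And>a b. (LINT x:box a b|lborel. g x) = 0"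
  shows "AE x in lborel. g x = 0"
proof -
  have meas [measurable]: "(\<lambda>x. ennreal (g x)) \<in> borel_measurable lborel"
    "(\<lambda>x. ennreal (- g x)) \<in> borel_measurable lborel" by auto
  let ?M = "density lborel (\<lambda>x. ennreal (g x))" and ?N = "density lborel (\<lambda>x. ennreal (- g x))"
  have pos: "emeasure ?M (box a b) = (\<integral>\<^sup>+x. ennreal (indicator (box a b) x * g x) \<partial>lborel)"
    and neg: "emeasure ?N (box a b) = (\<integral>\<^sup>+x. ennreal (- (indicator (box a b) x * g x)) \<partial>lborel)" for a b
    by (auto simp: emeasure_density intro!: nn_integral_cong split: split_indicator)
  have "?M = ?N"
  proof (rule measure_eqI_generator_eq)
    let ?E = "range (\<lambda>(a, b). box a b::'a set)"
    show "Int_stable ?E" by (auto simp: Int_stable_def box_Int_box)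
    show "?E \<subseteq> Pow UNIV" "sets ?M = sigma_sets UNIV ?E" "sets ?N = sigma_sets UNIV ?E"
      by (simp_all add: borel_eq_box)
    let ?A = "\<lambda>n::nat. box (- (real n *\<^sub>R One)) (real n *\<^sub>R One) :: 'a set"
    show "range ?A \<subseteq> ?E" "(\<Union>i. ?A i) = UNIV" unfolding UN_box_eq_UNIV by auto
    have I: "integrable lborel (\<lambda>x. indicator (box a b) x * g x)" for a b
      using int[of a b] by (simp add: set_integrable_def)
    have fin: "emeasure ?M (box a b) \<noteq> \<infinity>" "emeasure ?N (box a b) \<noteq> \<infinity>" for a b
      using I[of a b] unfolding pos neg real_integrable_def by auto
    then show "emeasure ?M (?A i) \<noteq> \<infinity>" for i by blast
    have "enn2real (emeasure ?M (box a b)) - enn2real (emeasure ?N (box a b)) = 0" for a b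
      using zero[of a b] real_lebesgue_integral_def[OF I[of a b]]
      unfolding pos neg set_lebesgue_integral_def by simp
    then have "emeasure ?M (box a b) = emeasure ?N (box a b)" for a b
      using fin[of a b]
      by (metis ennreal_enn2real_if eq_iff_diff_eq_0 infinity_ennreal_def)
    then show "emeasure ?M X = emeasure ?N X" if "X \<in> ?E" for X using that by auto
  qed
  then have "AE x in lborel. ennreal (g x) = ennreal (- g x)"
    by (rule sigma_finite_measure.density_unique[OF lborel.sigma_finite_measure_axioms meas])
  then show ?thesis
  proof eventually_elim
    case (elim x)
    show ?case
    proof (cases "0 \<le> g x")
      case True
      with elim have "ennreal (g x) = 0" by (simp add: ennreal_neg)
      with True show ?thesis by simp
    next
      case False
      with elim have "ennreal (- g x) = 0" by (simp add: ennreal_neg)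
      with False show ?thesis by simp
    qed
  qed
qed

text \<open>After passing to a Borel representative, testing with the bumps and letting them fill a
  box shows that all box integrals vanish. The limit is dominated by the function restricted to the
  closed box, which is compact, so local integrability suffices.\<close>

lemma fundamental_lemma:
  fixes g :: "'a::euclidean_space \<Rightarrow> real"
  assumes g: "g \<in> Lp_loc UNIV 1"
    and zero: "\<And>\<phi>. \<phi> \<in> test_functions UNIV \<Longrightarrow> (LINT x|lebesgue. g x * \<phi> x) = 0"
  shows "AE x in lebesgue. g x = 0"
proof -
  obtain h where h [measurable]: "h \<in> borel_measurable borel" and gh: "AE x in lborel. g x = h x"
    using completion_ex_borel_measurable_real[OF Lp_loc_measurable[OF g]] by auto
  have gh': "AE x in lebesgue. g x = h x" using AE_completion[OF gh] .
  have int: "integrable lborel (\<lambda>x. indicator (cbox a b) x * h x)" for a b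
  proof -
    have "integrable lebesgue (\<lambda>x. indicator (cbox a b) x * g x)"
      using g compact_cbox[of a b] by (auto simp: Lp_loc_1_iff set_integrable_def)
    then have "integrable lebesgue (\<lambda>x. indicator (cbox a b) x * h x)"
    proof (rule integrable_cong_AE_imp)
      show "(\<lambda>x. indicator (cbox a b) x * h x) \<in> borel_measurable lebesgue"
        by (intro measurable_completion) simp
      show "AE x in lebesgue. indicator (cbox a b) x * g x = indicator (cbox a b) x * h x"
        using gh' by eventually_elim simp
    qed
    then show ?thesis by (subst (asm) integrable_completion) auto
  qed
  have "AE x in lborel. h x = 0"
  proof (rule AE_zero_if_box_integrals_zero)
    fix a b :: 'a
    have dom: "integrable lborel (\<lambda>x. \<bar>indicator (cbox a b) x * h x\<bar>)"
      using int by (rule integrable_abs)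
    have "integrable lborel (\<lambda>x. indicator (box a b) x * h x)"
      using dom by (rule Bochner_Integration.integrable_bound)
        (use box_subset_cbox[of a b] in \<open>auto split: split_indicator\<close>)
    then show "set_integrable lborel (box a b) h" by (simp add: set_integrable_def)
    have "(\<lambda>n. LINT x|lborel. h x * box_bump a b n x) \<longlonglongrightarrow> (LINT x|lborel. h x * indicator (box a b) x)"
    proof (rule integral_dominated_convergence[OF _ _ dom])
      have [measurable]: "box_bump a b n \<in> borel_measurable borel" for n
        by (rule test_function_borel[OF box_bump_test])
      show "(\<lambda>x. h x * box_bump a b n x) \<in> borel_measurable lborel" for n by measurable
      show "AE x in lborel. (\<lambda>n. h x * box_bump a b n x) \<longlonglongrightarrow> h x * indicator (box a b) x"
        by (intro AE_I2 tendsto_mult tendsto_const box_bump_tendsto)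
      have "norm (h x * box_bump a b n x) \<le> \<bar>indicator (cbox a b) x * h x\<bar>" for n x
      proof (cases "x \<in> box a b")
        case True
        then have "x \<in> cbox a b" using box_subset_cbox by blast
        then show ?thesis
          using box_bump_bounds[of a b n x] by (simp add: abs_mult mult_left_le)
      qed (simp add: box_bump_outside)
      then show "AE x in lborel. norm (h x * box_bump a b n x) \<le> \<bar>indicator (cbox a b) x * h x\<bar>" for n
        by simp
    qed auto
    moreover have "(LINT x|lborel. h x * box_bump a b n x) = 0" for n
    proof -
      have [measurable]: "box_bump a b n \<in> borel_measurable borel"
        by (rule test_function_borel[OF box_bump_test])
      have "(LINT x|lborel. h x * box_bump a b n x) = (LINT x|lebesgue. h x * box_bump a b n x)"
        by (rule integral_completion[symmetric]) measurable
      also have "\<dots> = (LINT x|lebesgue. g x * box_bump a b n x)"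
      proof (rule integral_cong_AE)
        show "(\<lambda>x. h x * box_bump a b n x) \<in> borel_measurable lebesgue"
          by (intro measurable_completion) simp
        show "(\<lambda>x. g x * box_bump a b n x) \<in> borel_measurable lebesgue"
          using integrable_Lp_loc_mult_test[OF g box_bump_test] by (rule borel_measurable_integrable)
        show "AE x in lebesgue. h x * box_bump a b n x = g x * box_bump a b n x"
          using gh' by eventually_elim simp
      qed
      finally show ?thesis using zero[OF box_bump_test] by simp
    qed
    ultimately show "(LINT x:box a b|lborel. h x) = 0"
      by (simp add: set_lebesgue_integral_def LIMSEQ_const_iff mult.commute)
  qed simp
  then have "AE x in lebesgue. h x = 0" by (rule AE_completion)
  with gh' show ?thesis by eventually_elim simp
qed

section \<open>Weak derivatives and their uniqueness almost everywhere\<close>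

lemma has_weak_partialD:
  assumes "has_weak_partial UNIV e f g"
  shows "f \<in> Lp_loc UNIV 1" "g \<in> Lp_loc UNIV 1"
    "\<phi> \<in> test_functions UNIV \<Longrightarrow>
      (LINT x|lebesgue. f x * frechet_derivative \<phi> (at x) e) = - (LINT x|lebesgue. g x * \<phi> x)"
  using assms unfolding has_weak_partial_def set_lebesgue_integral_def
  by (blast, blast, simp only: indicator_UNIV scaleR_one)

lemma Lp_loc_1_add_cmult:
  assumes "f \<in> Lp_loc UNIV 1" "g \<in> Lp_loc UNIV 1"
  shows "(\<lambda>x. f x + c * g x) \<in> Lp_loc UNIV 1"
  unfolding Lp_loc_1_iff
proof (intro conjI allI impI)
  show "(\<lambda>x. f x + c * g x) \<in> borel_measurable lebesgue"
    using assms[THEN Lp_loc_measurable] by (intro borel_measurable_add borel_measurable_times) auto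
  fix K :: "'a set" assume "compact K"
  then have "set_integrable lebesgue K f" "set_integrable lebesgue K g"
    using assms by (simp_all only: Lp_loc_1_iff)
  then show "set_integrable lebesgue K (\<lambda>x. f x + c * g x)"
    by (intro set_integral_add set_integrable_mult_right) auto
qed

lemma has_weak_partial_unique:
  fixes f :: "'a::euclidean_space \<Rightarrow> real"
  assumes "has_weak_partial UNIV e f g" "has_weak_partial UNIV e f g'"
  shows "AE x in lebesgue. g x = g' x"
proof -
  have L: "g \<in> Lp_loc UNIV 1" "g' \<in> Lp_loc UNIV 1"
    by (rule has_weak_partialD(1)[OF assms(1)] has_weak_partialD(1)[OF assms(2)]
        has_weak_partialD(2)[OF assms(1)] has_weak_partialD(2)[OF assms(2)])+
  have "AE x in lebesgue. g x - g' x = 0"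
  proof (rule fundamental_lemma)
    show "(\<lambda>x. g x - g' x) \<in> Lp_loc UNIV 1"
      using Lp_loc_1_add_cmult[OF L, of "-1"] by simp
    fix \<phi> :: "'a \<Rightarrow> real" assume \<phi>: "\<phi> \<in> test_functions UNIV"
    have "(LINT x|lebesgue. g x * \<phi> x) = (LINT x|lebesgue. g' x * \<phi> x)"
      using has_weak_partialD(3)[OF assms(1) \<phi>] has_weak_partialD(3)[OF assms(2) \<phi>] by simp
    then show "(LINT x|lebesgue. (g x - g' x) * \<phi> x) = 0"
      using integrable_Lp_loc_mult_test[OF L(1) \<phi>] integrable_Lp_loc_mult_test[OF L(2) \<phi>]
      by (simp add: left_diff_distrib)
  qed
  then show ?thesis by simp
qed

text \<open>\<open>weak_partial\<close> is an arbitrary choice among representatives. Uniqueness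
  determines it up to null sets, which is all that the area integral sees, so explicit derivatives
  may be substituted there.\<close>

lemma weak_partial_AE_eq:
  fixes f :: "'a::euclidean_space \<Rightarrow> real"
  assumes "has_weak_partial UNIV e f g"
  shows "AE x in lebesgue. weak_partial UNIV e f x = g x"
  unfolding weak_partial_def
  using has_weak_partial_unique[OF someI[of "has_weak_partial UNIV e f", OF assms] assms] .

lemma has_weak_partial_add_cmult:
  fixes f f' :: "'a::euclidean_space \<Rightarrow> real"
  assumes "has_weak_partial UNIV e f g" "has_weak_partial UNIV e f' g'" and e: "e \<in> Basis"
  shows "has_weak_partial UNIV e (\<lambda>x. f x + c * f' x) (\<lambda>x. g x + c * g' x)"
proof -
  have L: "f \<in> Lp_loc UNIV 1" "f' \<in> Lp_loc UNIV 1" "g \<in> Lp_loc UNIV 1" "g' \<in> Lp_loc UNIV 1"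
    by (rule has_weak_partialD(1)[OF assms(1)] has_weak_partialD(1)[OF assms(2)]
        has_weak_partialD(2)[OF assms(1)] has_weak_partialD(2)[OF assms(2)])+
  have "(\<lambda>x. f x + c * f' x) \<in> Lp_loc UNIV 1" "(\<lambda>x. g x + c * g' x) \<in> Lp_loc UNIV 1"
    by (intro Lp_loc_1_add_cmult L)+
  moreover have "(LINT x|lebesgue. (f x + c * f' x) * frechet_derivative \<phi> (at x) e) =
      - (LINT x|lebesgue. (g x + c * g' x) * \<phi> x)" if \<phi>: "\<phi> \<in> test_functions UNIV" for \<phi>
  proof -
    note d = test_function_partial[OF \<phi> e]
    note I = integrable_Lp_loc_mult_test[OF L(1) d] integrable_Lp_loc_mult_test[OF L(2) d]
      integrable_Lp_loc_mult_test[OF L(3) \<phi>] integrable_Lp_loc_mult_test[OF L(4) \<phi>]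
    have "(LINT x|lebesgue. f x * frechet_derivative \<phi> (at x) e) = - (LINT x|lebesgue. g x * \<phi> x)"
      "(LINT x|lebesgue. f' x * frechet_derivative \<phi> (at x) e) = - (LINT x|lebesgue. g' x * \<phi> x)"
      by (rule has_weak_partialD(3)[OF assms(1) \<phi>] has_weak_partialD(3)[OF assms(2) \<phi>])+
    then show ?thesis using I by (simp add: distrib_right mult.assoc)
  qed
  ultimately show ?thesis by (simp add: has_weak_partial_def set_lebesgue_integral_def)
qed

section \<open>Integration by parts\<close>

text \<open>Dominated convergence along sequences: by the mean value theorem the difference
  quotients are values of \<open>F'\<close> at intermediate parameters, hence bounded by
  \<open>G\<close> once the increment is shorter than 1.\<close>

lemma has_real_derivative_integral:
  fixes F :: "real \<Rightarrow> 'a \<Rightarrow> real"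
  assumes int: "\<And>s. integrable M (F s)"
    and meas: "F' e \<in> borel_measurable M"
    and deriv: "\<And>s x. ((\<lambda>s. F s x) has_real_derivative F' s x) (at s)"
    and G: "integrable M G"
    and bound: "\<And>s x. \<bar>s - e\<bar> < 1 \<Longrightarrow> \<bar>F' s x\<bar> \<le> G x"
  shows "((\<lambda>s. \<integral>x. F s x \<partial>M) has_real_derivative (\<integral>x. F' e x \<partial>M)) (at e)"
  unfolding DERIV_def tendsto_at_iff_sequentially
proof (intro allI impI)
  fix X :: "nat \<Rightarrow> real" assume X: "\<forall>i. X i \<in> UNIV - {0}" "X \<longlonglongrightarrow> 0"
  obtain N where N: "\<And>n. n \<ge> N \<Longrightarrow> \<bar>X n\<bar> < 1"
    using LIMSEQ_D[OF X(2), of 1] by auto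
  \<comment> \<open>A tail of the sequence, whose increments are short enough for
    \<open>bound\<close> to apply; the shift is undone at the end.\<close>
  define Y where "Y n = X (n + N)" for n
  have Y: "Y n \<noteq> 0" "\<bar>Y n\<bar> < 1" for n using X(1) N by (auto simp: Y_def)
  have Y0: "Y \<longlonglongrightarrow> 0" unfolding Y_def using X(2) by (rule LIMSEQ_ignore_initial_segment)
  have meas_F: "F s \<in> borel_measurable M" for s using int by blast
  have "(\<lambda>n. \<integral>x. (F (e + Y n) x - F e x) / Y n \<partial>M) \<longlonglongrightarrow> (\<integral>x. F' e x \<partial>M)"
  proof (rule integral_dominated_convergence[OF meas _ G])
    show "(\<lambda>x. (F (e + Y n) x - F e x) / Y n) \<in> borel_measurable M" for n
      by (intro borel_measurable_divide borel_measurable_diff meas_F) simp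
    have "(\<lambda>n. (F (e + Y n) x - F e x) / Y n) \<longlonglongrightarrow> F' e x" for x
    proof -
      have "((\<lambda>h. (F (e + h) x - F e x) / h) \<longlongrightarrow> F' e x) (at 0)"
        using deriv[of x e] by (simp add: DERIV_def)
      moreover have "filterlim Y (at 0) sequentially"
        unfolding filterlim_at using Y0 Y(1) by auto
      ultimately show ?thesis by (rule filterlim_compose)
    qed
    then show "AE x in M. (\<lambda>n. (F (e + Y n) x - F e x) / Y n) \<longlonglongrightarrow> F' e x" by simp
    have "\<bar>F (e + h) x - F e x\<bar> \<le> G x * \<bar>h\<bar>" if "\<bar>h\<bar> < 1" for h x
    proof -
      \<comment> \<open>The mean value theorem needs an ordered pair of endpoints, so the sign of
        \<open>h\<close> is distinguished; for \<open>h = 0\<close> any admissible \<open>z\<close>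
        will do.\<close>
      have "\<exists>z. \<bar>z - e\<bar> < 1 \<and> F (e + h) x - F e x = h * F' z x"
      proof (cases h "0::real" rule: linorder_cases)
        case less
        then obtain z where "z > e + h" "z < e" "F e x - F (e + h) x = (e - (e + h)) * F' z x"
          using MVT2[of "e + h" e "\<lambda>s. F s x" "\<lambda>s. F' s x"] deriv by auto
        then show ?thesis using that by (intro exI[of _ z]) auto
      next
        case greater
        then obtain z where "z > e" "z < e + h" "F (e + h) x - F e x = (e + h - e) * F' z x"
          using MVT2[of e "e + h" "\<lambda>s. F s x" "\<lambda>s. F' s x"] deriv by auto
        then show ?thesis using that by (intro exI[of _ z]) auto
      qed (auto intro!: exI[of _ e])
      then obtain z where "\<bar>z - e\<bar> < 1" "F (e + h) x - F e x = h * F' z x" by blast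
      then show ?thesis using bound[of z x] by (simp add: abs_mult mult.commute[of "G x"] mult_left_mono)
    qed
    then have "\<bar>(F (e + Y n) x - F e x) / Y n\<bar> \<le> G x" for n x
      using Y[of n] by (simp add: abs_divide divide_le_eq)
    then show "AE x in M. norm ((F (e + Y n) x - F e x) / Y n) \<le> G x" for n by simp
  qed
  then have "(\<lambda>n. ((\<integral>x. F (e + Y n) x \<partial>M) - (\<integral>x. F e x \<partial>M)) / Y n) \<longlonglongrightarrow> (\<integral>x. F' e x \<partial>M)"
    using int by simp
  then show "((\<lambda>h. ((\<integral>x. F (e + h) x \<partial>M) - (\<integral>x. F e x \<partial>M)) / h) \<circ> X) \<longlonglongrightarrow> (\<integral>x. F' e x \<partial>M)"
    unfolding Y_def o_def by (rule LIMSEQ_offset[of _ N])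
qed

text \<open>Fubini together with the fundamental theorem of calculus on each slice. Continuity of
  the slice makes finitely many points without a derivative harmless, and a null set of slices may
  be bad. This is how the edges of the fan and the singular origin are absorbed.\<close>

lemma integral_partial_snd_zero:
  fixes u D :: "'a::euclidean_space \<times> real \<Rightarrow> real"
  assumes D: "integrable lborel D"
    and supp: "\<And>y t. R \<le> \<bar>t\<bar> \<Longrightarrow> u (y, t) = 0" "\<And>y t. R \<le> \<bar>t\<bar> \<Longrightarrow> D (y, t) = 0"
    and ae: "AE y in lborel. continuous_on UNIV (\<lambda>t. u (y, t)) \<and>
      (\<exists>S. finite S \<and> (\<forall>t. t \<notin> S \<longrightarrow> ((\<lambda>t. u (y, t)) has_real_derivative D (y, t)) (at t)))"
  shows "(LINT x|lborel. D x) = 0"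
proof -
  have D': "integrable (lborel \<Otimes>\<^sub>M lborel) D" using D by (simp add: lborel_prod)
  have "AE y in lborel. (LINT t|lborel. D (y, t)) = 0"
    using ae lborel_pair.AE_integrable_fst'[OF D']
  proof eventually_elim
    case (elim y)
    then obtain S where S: "finite S"
      "\<And>t. t \<notin> S \<Longrightarrow> ((\<lambda>t. u (y, t)) has_real_derivative D (y, t)) (at t)" by blast
    \<comment> \<open>The absolute value keeps the interval nonempty if \<open>R\<close> is
      negative; both endpoints satisfy the support condition.\<close>
    have "((\<lambda>t. D (y, t)) has_integral (u (y, \<bar>R\<bar>) - u (y, - \<bar>R\<bar>))) {- \<bar>R\<bar>..\<bar>R\<bar>}"
      using elim(1) S
      by (intro fundamental_theorem_of_calculus_interior_strong[of S])
        (auto simp: has_real_derivative_iff_has_vector_derivative[symmetric]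
          intro: continuous_on_subset)
    then have "((\<lambda>t. D (y, t)) has_integral 0) {- \<bar>R\<bar>..\<bar>R\<bar>}"
      using supp(1)[of "\<bar>R\<bar>" y] supp(1)[of "- \<bar>R\<bar>" y] by simp
    then have "((\<lambda>t. D (y, t)) has_integral 0) UNIV"
      by (rule has_integral_on_superset) (auto intro: supp(2))
    then show ?case
      using has_integral_integral_lborel[OF elim(2)] has_integral_unique by blast
  qed
  then have "(LINT y|lborel. LINT t|lborel. D (y, t)) = (LINT y|(lborel :: 'a measure). 0)"
    by (intro integral_cong_AE) (use lborel_pair.integrable_fst'[OF D'] in auto)
  then show ?thesis using lborel_pair.integral_fst'[OF D'] by (simp add: lborel_prod)
qed

lemma integral_partial_fst_zero:
  fixes u D :: "real \<times> 'a::euclidean_space \<Rightarrow> real"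
  assumes D: "integrable lborel D"
    and supp: "\<And>y t. R \<le> \<bar>y\<bar> \<Longrightarrow> u (y, t) = 0" "\<And>y t. R \<le> \<bar>y\<bar> \<Longrightarrow> D (y, t) = 0"
    and ae: "AE t in lborel. continuous_on UNIV (\<lambda>y. u (y, t)) \<and>
      (\<exists>S. finite S \<and> (\<forall>y. y \<notin> S \<longrightarrow> ((\<lambda>y. u (y, t)) has_real_derivative D (y, t)) (at y)))"
  shows "(LINT x|lborel. D x) = 0"
proof -
  have D': "integrable (lborel \<Otimes>\<^sub>M lborel) D" using D by (simp add: lborel_prod)
  have "(LINT (t, y)|lborel. D (y, t)) = 0"
  proof (rule integral_partial_snd_zero[where u="\<lambda>(t, y). u (y, t)"])
    show "integrable lborel (\<lambda>(t, y). D (y, t))"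
      using lborel_pair.integrable_product_swap[OF D'] by (simp add: lborel_prod)
  qed (use supp ae in auto)
  then show ?thesis
    using lborel_pair.integral_product_swap[of D] D' by (simp add: lborel_prod)
qed

section \<open>Partial derivatives of test functions on the plane\<close>

abbreviation D_y :: "(real \<times> real \<Rightarrow> real) \<Rightarrow> real \<times> real \<Rightarrow> real" where
  "D_y \<phi> x \<equiv> frechet_derivative \<phi> (at x) (1, 0)"

abbreviation D_t :: "(real \<times> real \<Rightarrow> real) \<Rightarrow> real \<times> real \<Rightarrow> real" where
  "D_t \<phi> x \<equiv> frechet_derivative \<phi> (at x) (0, 1)"

lemma Basis_real2: "(Basis :: (real \<times> real) set) = {(1, 0), (0, 1)}"
  by (auto simp: Basis_prod_def)

lemma test_function_D_y: "\<phi> \<in> test_functions \<omega> \<Longrightarrow> D_y \<phi> \<in> test_functions \<omega>"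
  and test_function_D_t: "\<phi> \<in> test_functions \<omega> \<Longrightarrow> D_t \<phi> \<in> test_functions \<omega>"
  by (simp_all add: test_function_partial Basis_real2)

lemma test_function_deriv_y:
  assumes "\<phi> \<in> test_functions \<omega>"
  shows "((\<lambda>y. \<phi> (y, t)) has_real_derivative D_y \<phi> (y, t)) (at y)"
proof -
  have "((\<lambda>y. (y, t)) has_derivative (\<lambda>h. (h, 0))) (at y)"
    by (auto intro!: derivative_eq_intros)
  from has_derivative_compose[OF this test_function_has_derivative[OF assms]]
  have *: "((\<lambda>y. \<phi> (y, t)) has_derivative (\<lambda>h. frechet_derivative \<phi> (at (y, t)) (h, 0))) (at y)" .
  have "linear (frechet_derivative \<phi> (at (y, t)))"
    by (rule linear_frechet_derivative[OF test_function_differentiable[OF assms]])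
  then have "frechet_derivative \<phi> (at (y, t)) (h, 0) = D_y \<phi> (y, t) * h" for h
    using linear_scale[of "frechet_derivative \<phi> (at (y, t))" h "(1, 0)"] by (simp add: mult.commute)
  then have "(\<lambda>h. frechet_derivative \<phi> (at (y, t)) (h, 0)) = (*) (D_y \<phi> (y, t))"
    by (rule ext)
  with * show ?thesis by (simp only: has_field_derivative_def)
qed

lemma test_function_deriv_t:
  assumes "\<phi> \<in> test_functions \<omega>"
  shows "((\<lambda>t. \<phi> (y, t)) has_real_derivative D_t \<phi> (y, t)) (at t)"
proof -
  have "((\<lambda>t. (y, t)) has_derivative (\<lambda>h. (0, h))) (at t)"
    by (auto intro!: derivative_eq_intros)
  from has_derivative_compose[OF this test_function_has_derivative[OF assms]]
  have *: "((\<lambda>t. \<phi> (y, t)) has_derivative (\<lambda>h. frechet_derivative \<phi> (at (y, t)) (0, h))) (at t)" .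
  have "linear (frechet_derivative \<phi> (at (y, t)))"
    by (rule linear_frechet_derivative[OF test_function_differentiable[OF assms]])
  then have "frechet_derivative \<phi> (at (y, t)) (0, h) = D_t \<phi> (y, t) * h" for h
    using linear_scale[of "frechet_derivative \<phi> (at (y, t))" h "(0, 1)"] by (simp add: mult.commute)
  then have "(\<lambda>h. frechet_derivative \<phi> (at (y, t)) (0, h)) = (*) (D_t \<phi> (y, t))"
    by (rule ext)
  with * show ?thesis by (simp only: has_field_derivative_def)
qed

lemma test_function_continuous_slices:
  assumes "\<phi> \<in> test_functions \<omega>"
  shows "continuous_on S (\<lambda>y. \<phi> (y, t))" "continuous_on S (\<lambda>t. \<phi> (y, t))"
proof -
  note cont = test_function_continuous[OF assms]
  show "continuous_on S (\<lambda>y. \<phi> (y, t))"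
    by (rule continuous_on_compose2[OF cont]) (intro continuous_on_Pair continuous_on_id continuous_on_const, simp)
  show "continuous_on S (\<lambda>t. \<phi> (y, t))"
    by (rule continuous_on_compose2[OF cont]) (intro continuous_on_Pair continuous_on_id continuous_on_const, simp)
qed

text \<open>The increment of \<open>\<phi>\<close> in \<open>t\<close> is the integral of
  \<open>D_t \<phi>\<close>. Differentiating it in \<open>y\<close> under the integral expresses the
  increment of \<open>D_y \<phi>\<close> as an integral of \<open>D_y (D_t \<phi>)\<close>, and
  differentiating that in \<open>t\<close> gives the symmetry. It is what makes the Jacobian
  integral vanish.\<close>

lemma test_function_mixed_partials:
  assumes \<phi>: "\<phi> \<in> test_functions \<omega>"
  shows "D_t (D_y \<phi>) x = D_y (D_t \<phi>) x"
proof -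
  obtain y s where x: "x = (y, s)" by force
  note \<phi>y = test_function_D_y[OF \<phi>] and \<phi>t = test_function_D_t[OF \<phi>]
  note \<phi>ty = test_function_D_y[OF \<phi>t]
  have cont: "continuous_on S (D_y (D_t \<phi>))" for S
    using test_function_continuous[OF \<phi>ty] continuous_on_subset by blast
  define c where "c = s - 1"
  have eq: "D_y \<phi> (y, t) - D_y \<phi> (y, c) = integral {c..t} (\<lambda>\<tau>. D_y (D_t \<phi>) (y, \<tau>))"
    if "c \<le> t" for t
  proof -
    have ftc: "integral {c..t} (\<lambda>\<tau>. D_t \<phi> (z, \<tau>)) = \<phi> (z, t) - \<phi> (z, c)" for z
      by (intro integral_unique fundamental_theorem_of_calculus that)
        (auto simp: has_real_derivative_iff_has_vector_derivative[symmetric]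
          intro!: has_field_derivative_at_within test_function_deriv_t[OF \<phi>])
    have "((\<lambda>z. integral (cbox c t) (\<lambda>\<tau>. D_t \<phi> (z, \<tau>))) has_field_derivative
        integral (cbox c t) (\<lambda>\<tau>. D_y (D_t \<phi>) (y, \<tau>))) (at y within UNIV)"
    proof (rule leibniz_rule_field_derivative)
      show "((\<lambda>z. D_t \<phi> (z, \<tau>)) has_field_derivative D_y (D_t \<phi>) (z, \<tau>)) (at z within UNIV)" for z \<tau>
        using test_function_deriv_y[OF \<phi>t] by simp
      show "(\<lambda>\<tau>. D_t \<phi> (z, \<tau>)) integrable_on cbox c t" for z
        by (intro integrable_continuous test_function_continuous_slices[OF \<phi>t])
      show "continuous_on (UNIV \<times> cbox c t) (\<lambda>(z, \<tau>). D_y (D_t \<phi>) (z, \<tau>))"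
        using cont by simp
    qed auto
    then have "((\<lambda>z. \<phi> (z, t) - \<phi> (z, c)) has_real_derivative
        integral {c..t} (\<lambda>\<tau>. D_y (D_t \<phi>) (y, \<tau>))) (at y)"
      by (simp add: ftc)
    moreover have "((\<lambda>z. \<phi> (z, t) - \<phi> (z, c)) has_real_derivative
        D_y \<phi> (y, t) - D_y \<phi> (y, c)) (at y)"
      by (intro DERIV_diff test_function_deriv_y[OF \<phi>])
    ultimately show ?thesis using DERIV_unique by blast
  qed
  have "((\<lambda>t. integral {c..t} (\<lambda>\<tau>. D_y (D_t \<phi>) (y, \<tau>))) has_real_derivative D_y (D_t \<phi>) (y, s))
      (at s within {c..s + 1})"
    by (intro integral_has_real_derivative test_function_continuous_slices[OF \<phi>ty])
      (auto simp: c_def)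
  then have "((\<lambda>t. integral {c..t} (\<lambda>\<tau>. D_y (D_t \<phi>) (y, \<tau>))) has_real_derivative D_y (D_t \<phi>) (y, s)) (at s)"
    by (simp add: c_def at_within_Icc_at)
  then have "((\<lambda>t. D_y \<phi> (y, t) - D_y \<phi> (y, c)) has_real_derivative D_y (D_t \<phi>) (y, s)) (at s)"
    by (rule has_field_derivative_transform_within_open[where S="{c<..}"])
      (auto simp: c_def eq[unfolded c_def])
  moreover have "((\<lambda>t. D_y \<phi> (y, t) - D_y \<phi> (y, c)) has_real_derivative D_t (D_y \<phi>) (y, s) - 0) (at s)"
    by (intro DERIV_diff test_function_deriv_t[OF \<phi>y] DERIV_const)
  ultimately show ?thesis using DERIV_unique x by fastforce
qed

lemma test_function_support_bound:
  fixes \<phi> :: "real \<times> real \<Rightarrow> real"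
  assumes "\<phi> \<in> test_functions \<omega>"
  obtains R where "\<And>y t. R \<le> \<bar>y\<bar> \<or> R \<le> \<bar>t\<bar> \<Longrightarrow> (y, t) \<notin> spt \<phi>"
proof -
  obtain B where B: "\<And>x. x \<in> spt \<phi> \<Longrightarrow> norm x \<le> B"
    using compact_imp_bounded[OF test_function_compact_spt[OF assms]] by (auto simp: bounded_iff)
  \<comment> \<open>\<open>B\<close> may be negative if the support is empty, hence the absolute
    value; the extra 1 makes the separation strict.\<close>
  have "(y, t) \<notin> spt \<phi>" if "\<bar>B\<bar> + 1 \<le> \<bar>y\<bar> \<or> \<bar>B\<bar> + 1 \<le> \<bar>t\<bar>" for y t
    using B[of "(y, t)"] norm_fst_le[of y t] norm_snd_le[of t y] that by auto
  then show ?thesis using that[of "\<bar>B\<bar> + 1"] by auto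
qed

section \<open>The cone\<close>

definition unit_slope :: "real \<Rightarrow> real" where
  "unit_slope x = x / sqrt (1 + x\<^sup>2)"

text \<open>The second derivative of the area integrand \<open>sqrt (1 + x\<^sup>2)\<close>, as
  \<open>unit_slope\<close> is the first. Its nonnegativity is the convexity on which stability
  rests.\<close>

definition area_weight :: "real \<Rightarrow> real" where
  "area_weight x = 1 / sqrt (1 + x\<^sup>2) ^ 3"

lemma sqrt_one_plus_sq_ge_1: "1 \<le> sqrt (1 + (x::real)\<^sup>2)"
  by simp

lemma unit_slope_deriv: "(unit_slope has_real_derivative area_weight x) (at x)"
proof -
  let ?s = "sqrt (1 + x\<^sup>2)"
  have pos: "1 + x\<^sup>2 > 0" by (simp add: add_pos_nonneg)
  have s: "?s > 0" "?s\<^sup>2 = 1 + x\<^sup>2" using pos by simp_all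
  have "((\<lambda>x. x / sqrt (1 + x\<^sup>2)) has_real_derivative (?s - x * (x / ?s)) / (?s * ?s)) (at x)"
    using pos by (auto intro!: derivative_eq_intros simp: field_simps)
  also have "?s - x * (x / ?s) = 1 / ?s"
    using s by (simp add: field_simps power2_eq_square)
  finally show ?thesis
    by (simp add: unit_slope_def[abs_def] area_weight_def power3_eq_cube mult.assoc mult.commute)
qed

lemma area_deriv: "((\<lambda>x. sqrt (1 + x\<^sup>2)) has_real_derivative unit_slope x) (at x)"
proof -
  have "1 + x\<^sup>2 > 0" by (simp add: add_pos_nonneg)
  then show ?thesis by (auto intro!: derivative_eq_intros simp: unit_slope_def divide_simps)
qed

lemma abs_unit_slope_le: "\<bar>unit_slope x\<bar> \<le> 1"
proof -
  have "\<bar>x\<bar> \<le> sqrt (1 + x\<^sup>2)" by (rule real_le_rsqrt) simp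
  moreover have "0 < sqrt (1 + x\<^sup>2)" using sqrt_one_plus_sq_ge_1[of x] by linarith
  ultimately show ?thesis by (simp only: unit_slope_def abs_divide abs_of_pos divide_le_eq_1_pos)
qed

lemma area_weight_bounds: "0 \<le> area_weight x" "area_weight x \<le> 1"
proof -
  have "0 \<le> 1 / r \<and> 1 / r \<le> 1" if "1 \<le> r" for r :: real using that by simp
  from this[OF one_le_power[OF sqrt_one_plus_sq_ge_1]]
  show "0 \<le> area_weight x" "area_weight x \<le> 1" by (simp_all only: area_weight_def)
qed

lemma unit_slope_continuous: "continuous_on UNIV unit_slope"
  using unit_slope_deriv by (blast intro: DERIV_continuous_on has_field_derivative_at_within)

lemma measurable_unit_slope [measurable]: "unit_slope \<in> borel_measurable borel"
  unfolding unit_slope_def[abs_def] by measurable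

lemma measurable_area_weight [measurable]: "area_weight \<in> borel_measurable borel"
  unfolding area_weight_def[abs_def] by measurable

text \<open>The order of the tests lets the quotient occur only for
  \<open>0 < snd x < (fst x)\<^sup>2\<close>, where it is well defined. There is no limit at the
  origin: along the parabola \<open>t = \<sigma> y\<^sup>2\<close> in the fan the value is
  constantly \<open>2 \<sigma>\<close>. The factor \<open>fst x\<close> in \<open>cone_fun\<close>
  restores continuity.\<close>

definition slope :: "real \<times> real \<Rightarrow> real" where
  "slope x = (if snd x \<le> 0 then 0 else if (fst x)\<^sup>2 \<le> snd x then 2 else 2 * snd x / (fst x)\<^sup>2)"

definition cone_fun :: "real \<times> real \<Rightarrow> real" where
  "cone_fun x = fst x * slope x"

definition fan :: "(real \<times> real) set" where
  "fan = {x. 0 < snd x \<and> snd x < (fst x)\<^sup>2}"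

definition slope_t :: "real \<times> real \<Rightarrow> real" where
  "slope_t x = (if x \<in> fan then 2 / (fst x)\<^sup>2 else 0)"

lemma borel_measurable_fst_snd [measurable (raw)]:
  "f \<in> M \<rightarrow>\<^sub>M (borel :: (real \<times> real) measure) \<Longrightarrow> (\<lambda>x. fst (f x)) \<in> borel_measurable M"
  "f \<in> M \<rightarrow>\<^sub>M (borel :: (real \<times> real) measure) \<Longrightarrow> (\<lambda>x. snd (f x)) \<in> borel_measurable M"
  by (erule measurable_compose, intro borel_measurable_continuous_onI continuous_on_fst continuous_on_snd continuous_on_id)+

lemma measurable_fan [measurable]: "fan \<in> sets borel"
  unfolding fan_def by measurable

lemma measurable_slope [measurable]: "slope \<in> borel_measurable borel"
  unfolding slope_def[abs_def] by measurable

lemma measurable_cone [measurable]: "cone_fun \<in> borel_measurable borel"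
  unfolding cone_fun_def[abs_def] by measurable

lemma measurable_slope_t [measurable]: "slope_t \<in> borel_measurable borel"
  unfolding slope_t_def[abs_def] by measurable

lemma slope_bounds: "0 \<le> slope x" "slope x \<le> 2"
  by (auto simp: slope_def divide_le_eq)

lemma fan_fst_nonzero: "x \<in> fan \<Longrightarrow> fst x \<noteq> 0"
  by (auto simp: fan_def)

lemma slope_deriv_t:
  assumes "t \<noteq> 0" "t \<noteq> y\<^sup>2"
  shows "((\<lambda>t. slope (y, t)) has_real_derivative slope_t (y, t)) (at t)"
proof -
  consider "t < 0" | "0 < t" "y\<^sup>2 < t" | "0 < t" "t < y\<^sup>2" using assms by linarith
  then show ?thesis
  proof cases
    case 1
    have "((\<lambda>_. 0) has_real_derivative slope_t (y, t)) (at t)" using 1 by (simp add: slope_t_def fan_def)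
    then show ?thesis
      by (rule has_field_derivative_transform_within_open[where S="{..<0}"])
        (use 1 in \<open>auto simp: slope_def\<close>)
  next
    case 2
    have "((\<lambda>_. 2) has_real_derivative slope_t (y, t)) (at t)" using 2 by (simp add: slope_t_def fan_def)
    then show ?thesis
      by (rule has_field_derivative_transform_within_open[where S="{y\<^sup>2<..}"])
        (use 2 in \<open>auto simp: slope_def dest: le_less_trans[OF zero_le_power2]\<close>)
  next
    case 3
    have "((\<lambda>t. 2 * t / y\<^sup>2) has_real_derivative slope_t (y, t)) (at t)"
      using DERIV_cdivide[OF DERIV_cmult_Id[where c=2], where c="y\<^sup>2"] 3
      by (simp add: slope_t_def fan_def)
    then show ?thesis
      by (rule has_field_derivative_transform_within_open[where S="{0<..<y\<^sup>2}"])
        (use 3 in \<open>auto simp: slope_def\<close>)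
  qed
qed

text \<open>The slope is constant along the characteristics, the integral curves of \<open>\<partial>\<^sub>y + cone_fun \<partial>\<^sub>t\<close>.\<close>

lemma slope_deriv_y:
  assumes "t \<noteq> 0" "t \<noteq> y\<^sup>2"
  shows "((\<lambda>y. slope (y, t)) has_real_derivative - (cone_fun (y, t) * slope_t (y, t))) (at y)"
proof -
  consider "t < 0" | "0 < t" "y\<^sup>2 < t" | "0 < t" "t < y\<^sup>2" using assms by linarith
  then show ?thesis
  proof cases
    case 1
    have "((\<lambda>_. 0) has_real_derivative - (cone_fun (y, t) * slope_t (y, t))) (at y)"
      using 1 by (simp add: slope_t_def fan_def)
    then show ?thesis
      by (rule has_field_derivative_transform_within_open[where S=UNIV])
        (use 1 in \<open>auto simp: slope_def\<close>)
  next
    case 2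
    have "((\<lambda>_. 2) has_real_derivative - (cone_fun (y, t) * slope_t (y, t))) (at y)"
      using 2 by (simp add: slope_t_def fan_def)
    then show ?thesis
      by (rule has_field_derivative_transform_within_open[where S="{z. z\<^sup>2 < t}"])
        (use 2 in \<open>auto simp: slope_def intro!: open_Collect_less continuous_intros\<close>)
  next
    case 3
    then have y: "y \<noteq> 0" by auto
    have "((\<lambda>y. 2 * t / y\<^sup>2) has_real_derivative - (4 * t / y ^ 3)) (at y)"
      using y by (auto intro!: derivative_eq_intros simp: field_simps eval_nat_numeral)
    also have "- (4 * t / y ^ 3) = - (cone_fun (y, t) * slope_t (y, t))"
      using 3 y by (auto simp: slope_t_def fan_def cone_fun_def slope_def field_simps eval_nat_numeral)
    finally show ?thesis
      by (rule has_field_derivative_transform_within_open[where S="{z. t < z\<^sup>2}"])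
        (use 3 in \<open>auto simp: slope_def intro!: open_Collect_less continuous_intros\<close>)
  qed
qed

text \<open>For \<open>y \<noteq> 0\<close> the slice is a linear function of \<open>t\<close>
  clamped to \<open>[0, 2]\<close>, whereas on \<open>y = 0\<close> it jumps from 0 to 2 at the
  origin.\<close>

lemma slope_continuous_t:
  assumes "y \<noteq> 0"
  shows "continuous_on UNIV (\<lambda>t. slope (y, t))"
proof -
  have "slope (y, t) = max 0 (min 2 (2 * t / y\<^sup>2))" for t
  proof -
    have y2: "0 < y\<^sup>2" using assms by simp
    consider "t \<le> 0" | "0 < t" "y\<^sup>2 \<le> t" | "0 < t" "t < y\<^sup>2" by linarith
    then show ?thesis
    proof cases
      case 1
      then have "2 * t / y\<^sup>2 \<le> 0" using y2 by (intro divide_nonpos_pos) auto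
      then show ?thesis using 1 by (simp add: slope_def)
    next
      case 2
      then have "2 \<le> 2 * t / y\<^sup>2" using y2 by (simp add: le_divide_eq)
      then show ?thesis using 2 by (simp add: slope_def)
    next
      case 3
      then have "2 * t / y\<^sup>2 \<le> 2" "0 \<le> 2 * t / y\<^sup>2" using y2 by (simp_all add: divide_le_eq)
      then show ?thesis using 3 by (simp add: slope_def)
    qed
  qed
  then show ?thesis using assms by (auto intro!: continuous_intros)
qed

lemma slope_continuous_y:
  assumes "t \<noteq> 0"
  shows "continuous_on UNIV (\<lambda>y. slope (y, t))"
proof (cases "t < 0")
  case True
  then show ?thesis by (simp add: slope_def)
next
  case False
  \<comment> \<open>For \<open>t > 0\<close> this single formula covers the fan and the region above
    it, with a denominator that stays positive.\<close>
  have "slope (y, t) = 2 * t / max t (y\<^sup>2)" for y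
    using False assms by (auto simp: slope_def max_def)
  moreover have "max t (y\<^sup>2) \<noteq> 0" for y using False assms by (auto simp: max_def)
  ultimately show ?thesis by (auto intro!: continuous_intros)
qed

lemma exception_sets:
  "finite {t. t = 0 \<or> t = (y::real)\<^sup>2}" "finite {y. (t::real) = y\<^sup>2}"
proof -
  show "finite {t. t = 0 \<or> t = (y::real)\<^sup>2}" by (simp add: Collect_disj_eq)
  have "{y. (t::real) = y\<^sup>2} \<subseteq> {sqrt t, - sqrt t}"
    by (auto simp: real_sqrt_abs abs_if)
  then show "finite {y. (t::real) = y\<^sup>2}" by (rule finite_subset) simp
qed

text \<open>The slice of the fan at \<open>y\<close> has length \<open>y\<^sup>2\<close>, so
  integrating in \<open>t\<close> turns the exponent \<open>- p\<close> into \<open>2 - p\<close>,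
  which exceeds -1.\<close>

lemma fan_power_integrable:
  assumes p: "p < 3"
  shows "integrable lborel (\<lambda>x. indicator (fan \<inter> {x. \<bar>fst x\<bar> \<le> R}) x * \<bar>fst x\<bar> powr (- p))"
proof -
  define S where "S = fan \<inter> {x. \<bar>fst x\<bar> \<le> R}"
  define u where "u x = indicator S x * \<bar>fst x\<bar> powr (- p)" for x :: "real \<times> real"
  have "{x :: real \<times> real. \<bar>fst x\<bar> \<le> R} \<in> sets borel" by measurable
  then have [measurable]: "S \<in> sets borel" unfolding S_def by (intro sets.Int measurable_fan)
  have [measurable]: "u \<in> borel_measurable borel" unfolding u_def[abs_def] by measurable
  have slice: "u (y, t) = (indicator {-R..R} y * \<bar>y\<bar> powr (- p)) * indicator {0<..<y\<^sup>2} t" for y t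
    by (auto simp: u_def S_def fan_def split: split_indicator)
  have "integrable (lborel \<Otimes>\<^sub>M lborel) u"
  proof (rule lborel_pair.Fubini_integrable)
    show "u \<in> borel_measurable (lborel \<Otimes>\<^sub>M lborel)" by (simp add: lborel_prod)
    show "AE y in lborel. integrable lborel (\<lambda>t. u (y, t))"
      unfolding slice by (intro AE_I2 integrable_mult_right) (auto intro: integrable_real_indicator)
    have inner: "(LINT t|lborel. norm (u (y, t))) = indicator {-R..R} y * \<bar>y\<bar> powr (2 - p)" for y
    proof -
      have "norm (u (y, t)) = u (y, t)" for t by (simp add: u_def)
      then have "(LINT t|lborel. norm (u (y, t))) = indicator {-R..R} y * \<bar>y\<bar> powr (- p) * y\<^sup>2"
        by (simp add: slice)
      \<comment> \<open>At \<open>y = 0\<close> both sides are 0, since \<open>0 powr a = 0\<close>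
        for every exponent.\<close>
      also have "\<dots> = indicator {-R..R} y * \<bar>y\<bar> powr (2 - p)"
        by (cases "y = 0") (simp_all add: powr_diff powr_minus field_simps)
      finally show ?thesis .
    qed
    have "integrable lborel (\<lambda>y. indicator {-R..R} y * \<bar>y\<bar> powr (2 - p))"
    proof (cases "R \<ge> 0")
      case True
      have "((\<lambda>y. y powr (2 - p)) has_integral (R powr (2 - p + 1) / (2 - p + 1))) {0..R}"
        using p True by (intro has_integral_powr_from_0) auto
      then have I: "(\<lambda>y. \<bar>y\<bar> powr (2 - p)) integrable_on {0..R}"
        by (rule integrable_eq[OF has_integral_integrable]) simp
      then have "(\<lambda>y. \<bar>- y\<bar> powr (2 - p)) integrable_on {- R..- 0}"
        by (rule iffD2[OF Henstock_Kurzweil_Integration.integrable_reflect_real[where f="\<lambda>y. \<bar>y\<bar> powr (2 - p)"]])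
      then have "(\<lambda>y. \<bar>y\<bar> powr (2 - p)) integrable_on {- R..R}"
        using I True
        by (intro Henstock_Kurzweil_Integration.integrable_combine[where a="-R" and c=0 and b=R]) simp_all
      then have "(\<lambda>y. \<bar>y\<bar> powr (2 - p)) absolutely_integrable_on {- R..R}"
        by (intro nonnegative_absolutely_integrable_1) auto
      then have "integrable lebesgue (\<lambda>y. indicator {-R..R} y * \<bar>y\<bar> powr (2 - p))"
        by (simp add: set_integrable_def)
      then show ?thesis by (subst (asm) integrable_completion) auto
    qed simp
    then show "integrable lborel (\<lambda>y. LINT t|lborel. norm (u (y, t)))"
      by (simp only: inner)
  qed
  then show ?thesis unfolding lborel_prod u_def[abs_def] S_def .
qed

section \<open>Local integrability\<close>

definition locally_bounded :: "('a::euclidean_space \<Rightarrow> real) \<Rightarrow> bool" where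
  "locally_bounded u \<longleftrightarrow>
    u \<in> borel_measurable borel \<and> (\<forall>R. \<exists>C. \<forall>x. norm x \<le> R \<longrightarrow> \<bar>u x\<bar> \<le> C)"

text \<open>This is the size of \<open>slope_t\<close> and of \<open>(\<partial>\<^sub>t cone_fun)\<^sup>2\<close>; it is locally integrable because
  the fan has width \<open>y\<^sup>2\<close>.\<close>

definition fan_weight :: "real \<times> real \<Rightarrow> real" where
  "fan_weight x = 1 + indicator fan x / (fst x)\<^sup>2"

text \<open>These functions form a module over the locally bounded ones, and each of them is
  integrable on balls. Integrability of the integrands in the variation formulas thereby reduces to
  closure rules, as long as each product has at most one factor that is singular on the fan.\<close>

definition fan_bounded :: "(real \<times> real \<Rightarrow> real) \<Rightarrow> bool" where
  "fan_bounded u \<longleftrightarrow>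
    u \<in> borel_measurable borel \<and> (\<forall>R. \<exists>C. \<forall>x. norm x \<le> R \<longrightarrow> \<bar>u x\<bar> \<le> C * fan_weight x)"

lemma fan_weight_ge_1: "1 \<le> fan_weight x"
  by (simp add: fan_weight_def)

lemma locally_boundedI:
  "u \<in> borel_measurable borel \<Longrightarrow> (\<And>x. \<bar>u x\<bar> \<le> C) \<Longrightarrow> locally_bounded u"
  by (auto simp: locally_bounded_def)

lemma locally_bounded_add:
  assumes "locally_bounded u" "locally_bounded v"
  shows "locally_bounded (\<lambda>x. u x + v x)"
  unfolding locally_bounded_def
proof (intro conjI allI)
  show "(\<lambda>x. u x + v x) \<in> borel_measurable borel"
    using assms by (auto simp: locally_bounded_def)
  fix R
  obtain C D where "\<forall>x. norm x \<le> R \<longrightarrow> \<bar>u x\<bar> \<le> C" "\<forall>x. norm x \<le> R \<longrightarrow> \<bar>v x\<bar> \<le> D"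
    using assms unfolding locally_bounded_def by meson
  then have "\<forall>x. norm x \<le> R \<longrightarrow> \<bar>u x + v x\<bar> \<le> C + D"
    by (meson abs_triangle_ineq add_mono order_trans)
  then show "\<exists>C. \<forall>x. norm x \<le> R \<longrightarrow> \<bar>u x + v x\<bar> \<le> C" by blast
qed

lemma locally_bounded_mult:
  assumes "locally_bounded u" "locally_bounded v"
  shows "locally_bounded (\<lambda>x. u x * v x)"
  unfolding locally_bounded_def
proof (intro conjI allI)
  show "(\<lambda>x. u x * v x) \<in> borel_measurable borel"
    using assms by (auto simp: locally_bounded_def)
  fix R
  obtain C D where "\<forall>x. norm x \<le> R \<longrightarrow> \<bar>u x\<bar> \<le> C" "\<forall>x. norm x \<le> R \<longrightarrow> \<bar>v x\<bar> \<le> D"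
    using assms unfolding locally_bounded_def by meson
  then have "\<forall>x. norm x \<le> R \<longrightarrow> \<bar>u x * v x\<bar> \<le> C * D"
    unfolding abs_mult by (meson abs_ge_zero mult_mono order_trans)
  then show "\<exists>C. \<forall>x. norm x \<le> R \<longrightarrow> \<bar>u x * v x\<bar> \<le> C" by blast
qed

lemma locally_bounded_const: "locally_bounded (\<lambda>_. c)"
  by (rule locally_boundedI[where C="\<bar>c\<bar>"]) auto

lemma locally_bounded_fst: "locally_bounded (fst :: real \<times> real \<Rightarrow> real)"
proof -
  have "\<bar>fst x\<bar> \<le> R" if "norm x \<le> R" for x :: "real \<times> real" and R
    using norm_fst_le[of "fst x" "snd x"] that by simp
  moreover have "(fst :: real \<times> real \<Rightarrow> real) \<in> borel_measurable borel"
    by (intro borel_measurable_continuous_onI continuous_on_fst continuous_on_id)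
  ultimately show ?thesis unfolding locally_bounded_def by blast
qed

lemma locally_bounded_slope: "locally_bounded slope"
  by (rule locally_boundedI[where C=2]) (auto simp: slope_bounds)

lemma locally_bounded_cone: "locally_bounded cone_fun"
  unfolding cone_fun_def[abs_def]
  by (intro locally_bounded_mult locally_bounded_fst locally_bounded_slope)

lemma locally_bounded_test: "\<phi> \<in> test_functions \<omega> \<Longrightarrow> locally_bounded \<phi>"
  by (metis locally_boundedI test_function_borel test_function_bounded)

lemma fan_bounded_locally_bounded:
  assumes "locally_bounded u"
  shows "fan_bounded u"
  unfolding fan_bounded_def
proof (intro conjI allI)
  show "u \<in> borel_measurable borel" using assms by (simp add: locally_bounded_def)
  fix R
  obtain C where C: "\<forall>x. norm x \<le> R \<longrightarrow> \<bar>u x\<bar> \<le> C"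
    using assms unfolding locally_bounded_def by meson
  have "\<bar>u x\<bar> \<le> \<bar>C\<bar> * fan_weight x" if "norm x \<le> R" for x
  proof -
    have "\<bar>u x\<bar> \<le> \<bar>C\<bar> * 1" using C that by fastforce
    also have "\<dots> \<le> \<bar>C\<bar> * fan_weight x" by (intro mult_left_mono fan_weight_ge_1) simp
    finally show ?thesis .
  qed
  then show "\<exists>C. \<forall>x. norm x \<le> R \<longrightarrow> \<bar>u x\<bar> \<le> C * fan_weight x" by blast
qed

lemma fan_bounded_add:
  assumes "fan_bounded u" "fan_bounded v"
  shows "fan_bounded (\<lambda>x. u x + v x)"
  unfolding fan_bounded_def
proof (intro conjI allI)
  show "(\<lambda>x. u x + v x) \<in> borel_measurable borel"
    using assms by (auto simp: fan_bounded_def)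
  fix R
  obtain C D where CD: "\<forall>x. norm x \<le> R \<longrightarrow> \<bar>u x\<bar> \<le> C * fan_weight x"
      "\<forall>x. norm x \<le> R \<longrightarrow> \<bar>v x\<bar> \<le> D * fan_weight x"
    using assms unfolding fan_bounded_def by meson
  have "\<bar>u x + v x\<bar> \<le> (C + D) * fan_weight x" if "norm x \<le> R" for x
    using CD[rule_format, OF that] abs_triangle_ineq[of "u x" "v x"] by (simp add: distrib_right)
  then show "\<exists>C. \<forall>x. norm x \<le> R \<longrightarrow> \<bar>u x + v x\<bar> \<le> C * fan_weight x" by blast
qed

lemma fan_bounded_mult:
  assumes "locally_bounded u" "fan_bounded v"
  shows "fan_bounded (\<lambda>x. u x * v x)"
  unfolding fan_bounded_def
proof (intro conjI allI)
  show "(\<lambda>x. u x * v x) \<in> borel_measurable borel"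
    using assms by (auto simp: fan_bounded_def locally_bounded_def)
  fix R
  obtain C D where CD: "\<forall>x. norm x \<le> R \<longrightarrow> \<bar>u x\<bar> \<le> C"
      "\<forall>x. norm x \<le> R \<longrightarrow> \<bar>v x\<bar> \<le> D * fan_weight x"
    using assms unfolding fan_bounded_def locally_bounded_def by meson
  have "\<bar>u x * v x\<bar> \<le> (C * D) * fan_weight x" if "norm x \<le> R" for x
  proof -
    have "\<bar>u x\<bar> * \<bar>v x\<bar> \<le> C * (D * fan_weight x)"
      using CD[rule_format, OF that] by (intro mult_mono) auto
    then show ?thesis by (simp add: abs_mult mult.assoc)
  qed
  then show "\<exists>C. \<forall>x. norm x \<le> R \<longrightarrow> \<bar>u x * v x\<bar> \<le> C * fan_weight x" by blast
qed

lemma fan_bounded_slope_t: "fan_bounded slope_t"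
proof -
  have "\<bar>slope_t x\<bar> \<le> 2 * fan_weight x" for x
    by (simp add: slope_t_def fan_weight_def)
  then show ?thesis unfolding fan_bounded_def by auto
qed

lemma fan_bounded_abs: "fan_bounded u \<Longrightarrow> fan_bounded (\<lambda>x. \<bar>u x\<bar>)"
  by (auto simp: fan_bounded_def)

lemma fan_bounded_integrable_ball:
  assumes u: "fan_bounded u"
  shows "integrable lborel (\<lambda>x. indicator (cball 0 R) x * u x)"
proof -
  have [measurable]: "u \<in> borel_measurable borel" "cball 0 R \<in> sets (borel :: (real \<times> real) measure)"
    using u by (simp_all add: fan_bounded_def)
  obtain C where C: "\<And>x. norm x \<le> R \<Longrightarrow> \<bar>u x\<bar> \<le> C * fan_weight x"
    using u unfolding fan_bounded_def by meson
  let ?S = "fan \<inter> {x. \<bar>fst x\<bar> \<le> R}"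
  \<comment> \<open>The majorant is \<open>fan_weight\<close> on the ball, with its singular part
    written as a power so that \<open>fan_power_integrable\<close> applies with
    \<open>p = 2\<close>.\<close>
  let ?v = "\<lambda>x. \<bar>C\<bar> * (indicator (cball 0 R) x + indicator ?S x * \<bar>fst x\<bar> powr (- 2))"
  have "integrable lborel (indicator (cball 0 R) :: real \<times> real \<Rightarrow> real)"
    by (rule integrable_real_indicator) (use emeasure_compact_finite[OF compact_cball] in auto)
  then have "integrable lborel ?v"
    using fan_power_integrable[of 2 R]
    by (intro integrable_mult_right Bochner_Integration.integrable_add) auto
  then show ?thesis
  proof (rule Bochner_Integration.integrable_bound)
    show "(\<lambda>x. indicator (cball 0 R) x * u x) \<in> borel_measurable lborel"
      by measurable
    have "\<bar>indicator (cball 0 R) x * u x\<bar> \<le> ?v x" for x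
    proof (cases "norm x \<le> R")
      case True
      then have "\<bar>fst x\<bar> \<le> R" using norm_fst_le[of "fst x" "snd x"] by simp
      then have "fan_weight x = indicator (cball 0 R) x + indicator ?S x * \<bar>fst x\<bar> powr (- 2)"
        using True fan_fst_nonzero[of x]
        by (auto simp: fan_weight_def powr_minus powr_numeral field_simps split: split_indicator)
      moreover have "C * fan_weight x \<le> \<bar>C\<bar> * fan_weight x"
        using fan_weight_ge_1[of x] by (intro mult_right_mono) auto
      ultimately show ?thesis using C[OF True] True by simp
    qed simp
    then show "AE x in lborel. norm (indicator (cball 0 R) x * u x) \<le> norm (?v x)"
      by (intro AE_I2) (smt (verit) real_norm_def)
  qed
qed

lemma fan_bounded_integrable:
  assumes u: "fan_bounded u" and \<phi>: "\<phi> \<in> test_functions \<omega>" and supp: "\<And>x. x \<notin> spt \<phi> \<Longrightarrow> u x = 0"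
  shows "integrable lborel u"
proof -
  obtain R where R: "\<And>x. x \<in> spt \<phi> \<Longrightarrow> norm x \<le> R"
    using compact_imp_bounded[OF test_function_compact_spt[OF \<phi>]] by (auto simp: bounded_iff)
  have "(\<lambda>x. indicator (cball 0 R) x * u x) = u"
    using R supp by (auto simp: fun_eq_iff split: split_indicator)
  then show ?thesis using fan_bounded_integrable_ball[OF u, of R] by simp
qed

lemma set_integrable_lebesgue_compact:
  fixes u :: "'a::euclidean_space \<Rightarrow> real"
  assumes "\<And>R. integrable lborel (\<lambda>x. indicator (cball 0 R) x * u x)"
    and meas [measurable]: "u \<in> borel_measurable borel" and K: "compact K"
  shows "set_integrable lebesgue K u"
proof -
  obtain R where "\<forall>x\<in>K. norm x \<le> R"
    using compact_imp_bounded[OF K] by (auto simp: bounded_iff)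
  then have R: "K \<subseteq> cball 0 R" by auto
  have [measurable]: "K \<in> sets borel" using K by (simp add: borel_compact)
  have "integrable lborel (\<lambda>x. indicator K x * u x)"
  proof (rule Bochner_Integration.integrable_bound[OF assms(1)[of R]])
    show "(\<lambda>x. indicator K x * u x) \<in> borel_measurable lborel" by measurable
    show "AE x in lborel. norm (indicator K x * u x) \<le> norm (indicator (cball 0 R) x * u x)"
      using R by (intro AE_I2) (auto split: split_indicator)
  qed
  then have "integrable lebesgue (\<lambda>x. indicator K x * u x)"
    by (subst integrable_completion) auto
  then show ?thesis by (simp add: set_integrable_def)
qed

lemma Lp_loc_1_fan_bounded:
  assumes "fan_bounded u"
  shows "u \<in> Lp_loc UNIV 1"
proof -
  have [measurable]: "u \<in> borel_measurable borel" using assms by (simp add: fan_bounded_def)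
  have "u \<in> borel_measurable lebesgue" by (intro measurable_completion) simp
  then show ?thesis
    unfolding Lp_loc_1_iff
    by (intro conjI allI impI set_integrable_lebesgue_compact fan_bounded_integrable_ball assms) simp_all
qed

lemma Lp_loc_locally_bounded:
  fixes u :: "'a::euclidean_space \<Rightarrow> real"
  assumes u: "locally_bounded u" and p: "p \<ge> 0"
  shows "u \<in> Lp_loc UNIV p"
proof -
  have [measurable]: "u \<in> borel_measurable borel" "cball 0 R \<in> sets (borel :: 'a measure)" for R
    using u by (simp_all add: locally_bounded_def)
  have "u \<in> borel_measurable lebesgue" by (intro measurable_completion) simp
  moreover have "integrable lborel (\<lambda>x. indicator (cball 0 R) x * \<bar>u x\<bar> powr p)" for R
  proof -
    obtain C where C: "\<And>x. norm x \<le> R \<Longrightarrow> \<bar>u x\<bar> \<le> C"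
      using u unfolding locally_bounded_def by meson
    have "integrable lborel (indicator (cball 0 R) :: 'a \<Rightarrow> real)"
      by (rule integrable_real_indicator) (use emeasure_compact_finite[OF compact_cball] in auto)
    then have "integrable lborel (\<lambda>x::'a. C powr p * indicator (cball 0 R) x)" by simp
    then show ?thesis
    proof (rule Bochner_Integration.integrable_bound)
      show "(\<lambda>x. indicator (cball 0 R) x * \<bar>u x\<bar> powr p) \<in> borel_measurable lborel"
        by measurable
      show "AE x in lborel. norm (indicator (cball 0 R) x * \<bar>u x\<bar> powr p)
          \<le> norm (C powr p * indicator (cball 0 R) x)"
        using C p by (intro AE_I2) (auto intro!: powr_mono2 split: split_indicator)
    qed
  qed
  then have "set_integrable lebesgue K (\<lambda>x. \<bar>u x\<bar> powr p)" if "compact K" for K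
    using that by (intro set_integrable_lebesgue_compact) auto
  ultimately show ?thesis by (simp add: Lp_loc_def lebesgue_on_UNIV_eq)
qed

text \<open>The product \<open>u \<phi>\<close> has integrable derivative and compact support, so
  its slices integrate to 0. The slice \<open>y = 0\<close> is null, and every other slice can fail
  to be differentiable only where it meets the edges \<open>t = 0\<close> and
  \<open>t = y\<^sup>2\<close> of the fan. The companion rule for \<open>y\<close> discards the
  slice \<open>t = 0\<close> instead.\<close>

lemma has_weak_partial_tI:
  assumes u: "fan_bounded u" and v: "fan_bounded v"
    and cont: "\<And>y. y \<noteq> 0 \<Longrightarrow> continuous_on UNIV (\<lambda>t. u (y, t))"
    and deriv: "\<And>y t. y \<noteq> 0 \<Longrightarrow> t \<noteq> 0 \<Longrightarrow> t \<noteq> y\<^sup>2 \<Longrightarrow>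
      ((\<lambda>t. u (y, t)) has_real_derivative v (y, t)) (at t)"
  shows "has_weak_partial UNIV (0, 1) u v"
  unfolding has_weak_partial_def
proof (intro conjI ballI Lp_loc_1_fan_bounded u v)
  fix \<phi> :: "real \<times> real \<Rightarrow> real" assume \<phi>: "\<phi> \<in> test_functions UNIV"
  note \<phi>t = test_function_D_t[OF \<phi>]
  obtain R where R: "\<And>y t. R \<le> \<bar>y\<bar> \<or> R \<le> \<bar>t\<bar> \<Longrightarrow> (y, t) \<notin> spt \<phi>"
    using test_function_support_bound[OF \<phi>] by metis
  have I: "integrable lborel (\<lambda>x. u x * D_t \<phi> x)" "integrable lborel (\<lambda>x. v x * \<phi> x)"
    using fan_bounded_mult[OF locally_bounded_test[OF \<phi>t] u] fan_bounded_mult[OF locally_bounded_test[OF \<phi>] v]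
    by (auto intro!: fan_bounded_integrable[OF _ \<phi>] simp: mult.commute not_in_spt test_function_partial_outside)
  have "(LINT x|lborel. u x * D_t \<phi> x + v x * \<phi> x) = 0"
  proof (rule integral_partial_snd_zero[where u="\<lambda>x. u x * \<phi> x" and R=R])
    show "integrable lborel (\<lambda>x. u x * D_t \<phi> x + v x * \<phi> x)"
      using I by (rule Bochner_Integration.integrable_add)
    show "u (y, t) * \<phi> (y, t) = 0" "u (y, t) * D_t \<phi> (y, t) + v (y, t) * \<phi> (y, t) = 0"
      if "R \<le> \<bar>t\<bar>" for y t
      using R[where y=y and t=t] that by (simp_all add: not_in_spt test_function_partial_outside)
    have slice: "continuous_on UNIV (\<lambda>t. u (y, t) * \<phi> (y, t)) \<and>
        (\<exists>S. finite S \<and> (\<forall>t. t \<notin> S \<longrightarrow> ((\<lambda>t. u (y, t) * \<phi> (y, t)) has_real_derivative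
          u (y, t) * D_t \<phi> (y, t) + v (y, t) * \<phi> (y, t)) (at t)))" if "y \<noteq> 0" for y
    proof (intro conjI exI allI impI)
      show "continuous_on UNIV (\<lambda>t. u (y, t) * \<phi> (y, t))"
        by (intro continuous_on_mult cont[OF that] test_function_continuous_slices[OF \<phi>])
      show "finite {t. t = 0 \<or> t = y\<^sup>2}" by (rule exception_sets)
      fix t assume "t \<notin> {t. t = 0 \<or> t = y\<^sup>2}"
      then show "((\<lambda>t. u (y, t) * \<phi> (y, t)) has_real_derivative
          u (y, t) * D_t \<phi> (y, t) + v (y, t) * \<phi> (y, t)) (at t)"
        using DERIV_mult[OF deriv[OF that] test_function_deriv_t[OF \<phi>], of t]
        by (simp add: add.commute mult.commute)
    qed
    show "AE y in lborel. continuous_on UNIV (\<lambda>t. u (y, t) * \<phi> (y, t)) \<and>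
        (\<exists>S. finite S \<and> (\<forall>t. t \<notin> S \<longrightarrow> ((\<lambda>t. u (y, t) * \<phi> (y, t)) has_real_derivative
          u (y, t) * D_t \<phi> (y, t) + v (y, t) * \<phi> (y, t)) (at t)))"
      by (rule eventually_mono[OF AE_lborel_singleton[of 0] slice])
  qed
  then have "(LINT x|lborel. u x * D_t \<phi> x) = - (LINT x|lborel. v x * \<phi> x)"
    using I by simp
  then show "(LINT x:UNIV|lebesgue. u x * D_t \<phi> x) = - (LINT x:UNIV|lebesgue. v x * \<phi> x)"
    using I by (simp add: set_lebesgue_integral_def integral_completion borel_measurable_integrable)
qed

lemma has_weak_partial_yI:
  assumes u: "fan_bounded u" and v: "fan_bounded v"
    and cont: "\<And>t. t \<noteq> 0 \<Longrightarrow> continuous_on UNIV (\<lambda>y. u (y, t))"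
    and deriv: "\<And>y t. t \<noteq> 0 \<Longrightarrow> t \<noteq> y\<^sup>2 \<Longrightarrow>
      ((\<lambda>y. u (y, t)) has_real_derivative v (y, t)) (at y)"
  shows "has_weak_partial UNIV (1, 0) u v"
  unfolding has_weak_partial_def
proof (intro conjI ballI Lp_loc_1_fan_bounded u v)
  fix \<phi> :: "real \<times> real \<Rightarrow> real" assume \<phi>: "\<phi> \<in> test_functions UNIV"
  note \<phi>y = test_function_D_y[OF \<phi>]
  obtain R where R: "\<And>y t. R \<le> \<bar>y\<bar> \<or> R \<le> \<bar>t\<bar> \<Longrightarrow> (y, t) \<notin> spt \<phi>"
    using test_function_support_bound[OF \<phi>] by metis
  have I: "integrable lborel (\<lambda>x. u x * D_y \<phi> x)" "integrable lborel (\<lambda>x. v x * \<phi> x)"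
    using fan_bounded_mult[OF locally_bounded_test[OF \<phi>y] u] fan_bounded_mult[OF locally_bounded_test[OF \<phi>] v]
    by (auto intro!: fan_bounded_integrable[OF _ \<phi>] simp: mult.commute not_in_spt test_function_partial_outside)
  have "(LINT x|lborel. u x * D_y \<phi> x + v x * \<phi> x) = 0"
  proof (rule integral_partial_fst_zero[where u="\<lambda>x. u x * \<phi> x" and R=R])
    show "integrable lborel (\<lambda>x. u x * D_y \<phi> x + v x * \<phi> x)"
      using I by (rule Bochner_Integration.integrable_add)
    show "u (y, t) * \<phi> (y, t) = 0" "u (y, t) * D_y \<phi> (y, t) + v (y, t) * \<phi> (y, t) = 0"
      if "R \<le> \<bar>y\<bar>" for y t
      using R[where y=y and t=t] that by (simp_all add: not_in_spt test_function_partial_outside)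
    have slice: "continuous_on UNIV (\<lambda>y. u (y, t) * \<phi> (y, t)) \<and>
        (\<exists>S. finite S \<and> (\<forall>y. y \<notin> S \<longrightarrow> ((\<lambda>y. u (y, t) * \<phi> (y, t)) has_real_derivative
          u (y, t) * D_y \<phi> (y, t) + v (y, t) * \<phi> (y, t)) (at y)))" if "t \<noteq> 0" for t
    proof (intro conjI exI allI impI)
      show "continuous_on UNIV (\<lambda>y. u (y, t) * \<phi> (y, t))"
        by (intro continuous_on_mult cont[OF that] test_function_continuous_slices[OF \<phi>])
      show "finite {y. t = y\<^sup>2}" by (rule exception_sets)
      fix y assume "y \<notin> {y. t = y\<^sup>2}"
      then show "((\<lambda>y. u (y, t) * \<phi> (y, t)) has_real_derivative
          u (y, t) * D_y \<phi> (y, t) + v (y, t) * \<phi> (y, t)) (at y)"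
        using DERIV_mult[OF deriv[OF that] test_function_deriv_y[OF \<phi>], of y]
        by (simp add: add.commute mult.commute)
    qed
    show "AE t in lborel. continuous_on UNIV (\<lambda>y. u (y, t) * \<phi> (y, t)) \<and>
        (\<exists>S. finite S \<and> (\<forall>y. y \<notin> S \<longrightarrow> ((\<lambda>y. u (y, t) * \<phi> (y, t)) has_real_derivative
          u (y, t) * D_y \<phi> (y, t) + v (y, t) * \<phi> (y, t)) (at y)))"
      by (rule eventually_mono[OF AE_lborel_singleton[of 0] slice])
  qed
  then have "(LINT x|lborel. u x * D_y \<phi> x) = - (LINT x|lborel. v x * \<phi> x)"
    using I by simp
  then show "(LINT x:UNIV|lebesgue. u x * D_y \<phi> x) = - (LINT x:UNIV|lebesgue. v x * \<phi> x)"
    using I by (simp add: set_lebesgue_integral_def integral_completion borel_measurable_integrable)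
qed

section \<open>Weak derivatives of the cone function and of its normal\<close>

definition cone_y :: "real \<times> real \<Rightarrow> real" where
  "cone_y x = slope x - fst x * (cone_fun x * slope_t x)"

definition cone_t :: "real \<times> real \<Rightarrow> real" where
  "cone_t x = fst x * slope_t x"

text \<open>Up to sign, a component of the horizontal unit normal of the graph; it is the function
  \<open>h\<close> of the overview.\<close>

definition unit_normal :: "real \<times> real \<Rightarrow> real" where
  "unit_normal x = unit_slope (slope x)"

definition unit_normal_t :: "real \<times> real \<Rightarrow> real" where
  "unit_normal_t x = area_weight (slope x) * slope_t x"

lemma slope_gradient: "cone_y x + cone_fun x * cone_t x = slope x"
  by (simp add: cone_y_def cone_t_def)

text \<open>On the fan the singularity cancels: \<open>y * (y w) * (2 / y\<^sup>2) = 2 w\<close>. So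
  the derivative in \<open>y\<close> is bounded, and only the derivative in \<open>t\<close> is
  singular.\<close>

lemma cone_y_eq: "cone_y x = slope x - 2 * slope x * indicator fan x"
  by (auto simp: cone_y_def cone_fun_def slope_t_def power2_eq_square split: split_indicator
      dest: fan_fst_nonzero)

text \<open>On the fan both sides are \<open>4 / y\<^sup>2\<close>. This brings the square of the
  singular derivative back into the class of \<open>fan_bounded\<close> functions.\<close>

lemma cone_t_squared: "(cone_t x)\<^sup>2 = 2 * slope_t x"
  by (auto simp: cone_t_def slope_t_def power2_eq_square dest: fan_fst_nonzero)

lemma locally_bounded_cone_y: "locally_bounded cone_y"
proof (rule locally_boundedI)
  show "cone_y \<in> borel_measurable borel" unfolding cone_y_eq[abs_def] by measurable
  show "\<bar>cone_y x\<bar> \<le> 2" for x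
    using slope_bounds[of x] by (auto simp: cone_y_eq split: split_indicator)
qed

lemma fan_bounded_cone_t: "fan_bounded cone_t"
  unfolding cone_t_def[abs_def]
  by (intro fan_bounded_mult locally_bounded_fst fan_bounded_slope_t)

lemma locally_bounded_normal: "locally_bounded unit_normal"
  unfolding unit_normal_def[abs_def]
  by (rule locally_boundedI[where C=1]) (auto simp: abs_unit_slope_le)

lemma locally_bounded_weight: "locally_bounded (\<lambda>x. area_weight (slope x))"
  by (rule locally_boundedI[where C=1]) (auto simp: area_weight_bounds)

lemma fan_bounded_normal_t: "fan_bounded unit_normal_t"
  unfolding unit_normal_t_def[abs_def]
  by (intro fan_bounded_mult locally_bounded_weight fan_bounded_slope_t)

lemma cone_weak_partials:
  "has_weak_partial UNIV (1, 0) cone_fun cone_y" "has_weak_partial UNIV (0, 1) cone_fun cone_t"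
proof -
  show "has_weak_partial UNIV (1, 0) cone_fun cone_y"
  proof (rule has_weak_partial_yI)
    show "continuous_on UNIV (\<lambda>y. cone_fun (y, t))" if "t \<noteq> 0" for t
      unfolding cone_fun_def fst_conv
      by (intro continuous_on_mult continuous_on_id slope_continuous_y that)
    show "((\<lambda>y. cone_fun (y, t)) has_real_derivative cone_y (y, t)) (at y)" if "t \<noteq> 0" "t \<noteq> y\<^sup>2" for y t
      using DERIV_mult[OF DERIV_ident slope_deriv_y[OF that]]
      unfolding cone_y_def by (simp add: cone_fun_def mult.commute)
  qed (intro fan_bounded_locally_bounded locally_bounded_cone locally_bounded_cone_y)+
  show "has_weak_partial UNIV (0, 1) cone_fun cone_t"
  proof (rule has_weak_partial_tI)
    show "continuous_on UNIV (\<lambda>t. cone_fun (y, t))" if "y \<noteq> 0" for y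
      unfolding cone_fun_def fst_conv
      by (intro continuous_on_mult continuous_on_const slope_continuous_t that)
    show "((\<lambda>t. cone_fun (y, t)) has_real_derivative cone_t (y, t)) (at t)" if "t \<noteq> 0" "t \<noteq> y\<^sup>2" for y t
      using DERIV_cmult[OF slope_deriv_t[OF that], of y] by (simp add: cone_fun_def cone_t_def)
  qed (intro fan_bounded_locally_bounded locally_bounded_cone fan_bounded_cone_t)+
qed

lemma normal_deriv_t:
  assumes "t \<noteq> 0" "t \<noteq> y\<^sup>2"
  shows "((\<lambda>t. unit_normal (y, t)) has_real_derivative unit_normal_t (y, t)) (at t)"
  unfolding unit_normal_def unit_normal_t_def
  by (rule DERIV_chain2[OF unit_slope_deriv slope_deriv_t[OF assms]])

lemma normal_deriv_y:
  assumes "t \<noteq> 0" "t \<noteq> y\<^sup>2"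
  shows "((\<lambda>y. unit_normal (y, t)) has_real_derivative - (cone_fun (y, t) * unit_normal_t (y, t))) (at y)"
  using DERIV_chain2[OF unit_slope_deriv slope_deriv_y[OF assms]]
  by (simp add: unit_normal_def unit_normal_t_def mult.left_commute)

lemma normal_continuous_t: "y \<noteq> 0 \<Longrightarrow> continuous_on UNIV (\<lambda>t. unit_normal (y, t))"
  unfolding unit_normal_def
  by (rule continuous_on_compose2[OF unit_slope_continuous slope_continuous_t]) auto

lemma normal_continuous_y: "t \<noteq> 0 \<Longrightarrow> continuous_on UNIV (\<lambda>y. unit_normal (y, t))"
  unfolding unit_normal_def
  by (rule continuous_on_compose2[OF unit_slope_continuous slope_continuous_y]) auto

lemma fan_bounded_cone_normal_t: "fan_bounded (\<lambda>x. cone_fun x * unit_normal_t x)"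
  by (intro fan_bounded_mult locally_bounded_cone fan_bounded_normal_t)

text \<open>Together these say that \<open>unit_normal\<close> is weakly constant along
  characteristics, which is the Euler-Lagrange equation. The edges of the fan contribute nothing
  because \<open>unit_normal\<close> is continuous across them away from the origin.\<close>

lemma normal_weak_partials:
  "has_weak_partial UNIV (1, 0) unit_normal (\<lambda>x. - (cone_fun x * unit_normal_t x))"
  "has_weak_partial UNIV (0, 1) unit_normal unit_normal_t"
proof -
  have "fan_bounded (\<lambda>x. - 1 * (cone_fun x * unit_normal_t x))"
    by (intro fan_bounded_mult locally_bounded_const fan_bounded_cone_normal_t)
  then show "has_weak_partial UNIV (1, 0) unit_normal (\<lambda>x. - (cone_fun x * unit_normal_t x))"
    by (intro has_weak_partial_yI[OF fan_bounded_locally_bounded[OF locally_bounded_normal]]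
        normal_deriv_y normal_continuous_y) simp_all
  show "has_weak_partial UNIV (0, 1) unit_normal unit_normal_t"
    by (intro has_weak_partial_tI[OF fan_bounded_locally_bounded[OF locally_bounded_normal]
          fan_bounded_normal_t] normal_deriv_t normal_continuous_t)
qed

text \<open>In the first variation \<open>D_t \<phi>\<close> is multiplied by
  \<open>unit_normal\<close> and \<open>cone_fun\<close> jointly, so the product has to be
  integrated by parts as one function.\<close>

lemma normal_cone_weak_partial_t:
  "has_weak_partial UNIV (0, 1) (\<lambda>x. unit_normal x * cone_fun x) (\<lambda>x. cone_fun x * unit_normal_t x + unit_normal x * cone_t x)"
proof (rule has_weak_partial_tI)
  show "continuous_on UNIV (\<lambda>t. unit_normal (y, t) * cone_fun (y, t))" if "y \<noteq> 0" for y
    unfolding cone_fun_def fst_conv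
    by (intro continuous_on_mult normal_continuous_t continuous_on_const slope_continuous_t that)
  show "((\<lambda>t. unit_normal (y, t) * cone_fun (y, t)) has_real_derivative
      cone_fun (y, t) * unit_normal_t (y, t) + unit_normal (y, t) * cone_t (y, t)) (at t)"
    if "t \<noteq> 0" "t \<noteq> y\<^sup>2" for y t
    using DERIV_mult[OF normal_deriv_t[OF that] DERIV_cmult[OF slope_deriv_t[OF that], of y]]
    by (simp add: cone_fun_def cone_t_def algebra_simps)
qed (intro fan_bounded_locally_bounded locally_bounded_mult locally_bounded_normal locally_bounded_cone
    fan_bounded_add fan_bounded_cone_normal_t fan_bounded_mult fan_bounded_cone_t)+

lemma test_function_weak_partials:
  assumes "\<phi> \<in> test_functions UNIV"
  shows "has_weak_partial UNIV (1, 0) \<phi> (D_y \<phi>)" "has_weak_partial UNIV (0, 1) \<phi> (D_t \<phi>)"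
  using assms
  by (auto intro!: has_weak_partial_yI has_weak_partial_tI fan_bounded_locally_bounded
      locally_bounded_test test_function_D_y test_function_D_t
      test_function_deriv_y test_function_deriv_t test_function_continuous_slices)

lemma cone_t_Lp_loc:
  assumes p: "0 \<le> p" "p < 3"
  shows "cone_t \<in> Lp_loc UNIV p"
proof -
  have [measurable]: "cone_t \<in> borel_measurable borel" "cball 0 R \<in> sets (borel :: (real \<times> real) measure)" for R
    using fan_bounded_cone_t by (simp_all add: fan_bounded_def)
  have "cone_t \<in> borel_measurable lebesgue" by (intro measurable_completion) simp
  moreover have "integrable lborel (\<lambda>x. indicator (cball 0 R) x * \<bar>cone_t x\<bar> powr p)" for R
  proof -
    let ?S = "fan \<inter> {x. \<bar>fst x\<bar> \<le> R}"
    have "integrable lborel (\<lambda>x. 2 powr p * (indicator ?S x * \<bar>fst x\<bar> powr (- p)))"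
      using fan_power_integrable[OF p(2), of R] by (rule integrable_mult_right)
    then show ?thesis
    proof (rule Bochner_Integration.integrable_bound)
      have "indicator (cball 0 R) x * \<bar>cone_t x\<bar> powr p \<le> 2 powr p * (indicator ?S x * \<bar>fst x\<bar> powr (- p))" for x
      proof (cases "x \<in> fan \<and> norm x \<le> R")
        case True
        then have nz: "fst x \<noteq> 0" and "\<bar>fst x\<bar> \<le> R"
          using fan_fst_nonzero norm_fst_le[of "fst x" "snd x"] by auto
        have "\<bar>cone_t x\<bar> = 2 / \<bar>fst x\<bar>"
          using True nz by (simp add: cone_t_def slope_t_def power2_eq_square abs_mult)
        then have "\<bar>cone_t x\<bar> powr p = 2 powr p * \<bar>fst x\<bar> powr (- p)"
          by (simp add: powr_divide powr_minus_divide)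
        then show ?thesis using True \<open>\<bar>fst x\<bar> \<le> R\<close> by simp
      next
        case False
        then have "indicator (cball 0 R) x * \<bar>cone_t x\<bar> powr p = 0"
          by (auto simp: cone_t_def slope_t_def split: split_indicator)
        moreover have "0 \<le> 2 powr p * (indicator ?S x * \<bar>fst x\<bar> powr (- p))" by simp
        ultimately show ?thesis by linarith
      qed
      then show "AE x in lborel. norm (indicator (cball 0 R) x * \<bar>cone_t x\<bar> powr p)
          \<le> norm (2 powr p * (indicator ?S x * \<bar>fst x\<bar> powr (- p)))"
        by (intro AE_I2) simp
      show "(\<lambda>x. indicator (cball 0 R) x * \<bar>cone_t x\<bar> powr p) \<in> borel_measurable lborel" by measurable
    qed
  qed
  then have "set_integrable lebesgue K (\<lambda>x. \<bar>cone_t x\<bar> powr p)" if "compact K" for K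
    using that by (intro set_integrable_lebesgue_compact) auto
  ultimately show ?thesis by (simp add: Lp_loc_def lebesgue_on_UNIV_eq)
qed

lemma cone_W1p_loc:
  assumes "0 \<le> p" "p < 3"
  shows "cone_fun \<in> W1p_loc UNIV p"
  using cone_weak_partials Lp_loc_locally_bounded[OF locally_bounded_cone_y assms(1)]
    Lp_loc_locally_bounded[OF locally_bounded_cone assms(1)] cone_t_Lp_loc[OF assms]
  by (auto simp: W1p_loc_def Basis_real2)

section \<open>Local Lipschitz continuity away from the origin\<close>

lemma abs_clamp_diff_le:
  fixes a b c a' b' :: real
  shows "\<bar>max c (min a b) - max c (min a' b')\<bar> \<le> \<bar>a - a'\<bar> + \<bar>b - b'\<bar>"
    "\<bar>min c (max a b) - min c (max a' b')\<bar> \<le> \<bar>a - a'\<bar> + \<bar>b - b'\<bar>"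
  by (auto simp: max_def min_def abs_if)

text \<open>Multiplying the clamp of \<open>2 t / y\<^sup>2\<close> to \<open>[0, 2]\<close> by
  \<open>y\<close> clamps \<open>2 t / y\<close> between 0 and \<open>2 y\<close>, with the order
  reversed for negative \<open>y\<close>. One formula then covers the fan and both adjacent
  regions.\<close>

lemma cone_clamp:
  "0 < y \<Longrightarrow> cone_fun (y, t) = max 0 (min (2 * y) (2 * (t / y)))"
  "y < 0 \<Longrightarrow> cone_fun (y, t) = min 0 (max (2 * y) (2 * (t / y)))"
proof -
  show "cone_fun (y, t) = max 0 (min (2 * y) (2 * (t / y)))" if "0 < y"
  proof -
    have "\<not> (y * y \<le> t \<and> t \<le> 0)" using mult_pos_pos[OF that that] by linarith
    with that show ?thesis
      by (auto simp: cone_fun_def slope_def max_def min_def field_simps power2_eq_square)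
  qed
  show "cone_fun (y, t) = min 0 (max (2 * y) (2 * (t / y)))" if "y < 0"
    using mult_neg_neg[OF that that] that
    by (auto simp: cone_fun_def slope_def max_def min_def field_simps power2_eq_square)
qed

text \<open>Off the axis \<open>y = 0\<close> the clamped form is used, where \<open>t / y\<close>
  is locally Lipschitz and clamping preserves this. Near a point of the axis other than the origin
  the function is simply 0 or \<open>2 y\<close>, according to the sign of \<open>t\<close>.\<close>

lemma locally_lipschitz_cone: "locally_lipschitz_on (UNIV - {0}) cone_fun"
  unfolding locally_lipschitz_on_def
proof
  fix x :: "real \<times> real" assume "x \<in> UNIV - {0}"
  obtain y0 t0 where x: "x = (y0, t0)" by force
  have dist: "\<bar>y - y'\<bar> \<le> dist (y, t) (y', t')" "\<bar>t - t'\<bar> \<le> dist (y, t) (y', t')" for y t y' t' :: real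
    using dist_fst_le[of "(y, t)" "(y', t')"] dist_snd_le[of "(y, t)" "(y', t')"]
    by (simp_all add: dist_real_def)
  have "y0 \<noteq> 0 \<or> t0 \<noteq> 0" using \<open>x \<in> UNIV - {0}\<close> by (auto simp: x zero_prod_def)
  then consider "y0 \<noteq> 0" | "y0 = 0" "t0 < 0" | "y0 = 0" "t0 > 0"
    by (metis linorder_neqE_linordered_idom)
  then show "\<exists>u>0. \<exists>L. L-lipschitz_on (cball x u \<inter> (UNIV - {0})) cone_fun"
  proof cases
    case 1
    \<comment> \<open>Half the distance to the axis: the ball of radius \<open>m\<close> stays on
      one side of it, with \<open>\<bar>y\<bar> \<ge> m\<close>.\<close>
    define m where "m = \<bar>y0\<bar> / 2"
    define T where "T = \<bar>t0\<bar> + m"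
    have m: "m > 0" using 1 by (simp add: m_def)
    have near: "m \<le> \<bar>y\<bar>" "\<bar>t\<bar> \<le> T" "0 < y \<longleftrightarrow> 0 < y0" if "(y, t) \<in> cball x m" for y t
    proof -
      have "\<bar>y0 - y\<bar> \<le> m" "\<bar>t0 - t\<bar> \<le> m"
        using dist[where y=y0 and t=t0 and y'=y and t'=t] that by (auto simp: x)
      then show "m \<le> \<bar>y\<bar>" "\<bar>t\<bar> \<le> T" "0 < y \<longleftrightarrow> 0 < y0"
        using m unfolding m_def T_def by (auto simp: abs_if split: if_splits)
    qed
    \<comment> \<open>The summand 2 bounds the variation of the clamp level \<open>2 y\<close>. In
      the Lipschitz constant of \<open>t / y\<close>, \<open>1 / m\<close> accounts for moving
      \<open>t\<close> and \<open>T / (m * m)\<close> for moving \<open>y\<close>.\<close>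
    define L where "L = 2 + 2 * (1 / m + T / (m * m))"
    have T: "T \<ge> 0" using m by (simp add: T_def)
    have "L-lipschitz_on (cball x m \<inter> (UNIV - {0})) cone_fun"
    proof (rule lipschitz_onI)
      show "0 \<le> L" using m T by (simp add: L_def)
      fix p q assume "p \<in> cball x m \<inter> (UNIV - {0})" "q \<in> cball x m \<inter> (UNIV - {0})"
      moreover obtain y t y' t' where pq: "p = (y, t)" "q = (y', t')" by (metis surj_pair)
      ultimately have p: "(y, t) \<in> cball x m" and q: "(y', t') \<in> cball x m" by auto
      note n = near[OF p] near[OF q]
      have nz: "y \<noteq> 0" "y' \<noteq> 0" using n(1,4) m by auto
      let ?d = "dist p q"
      have d: "\<bar>y - y'\<bar> \<le> ?d" "\<bar>t - t'\<bar> \<le> ?d" unfolding pq by (rule dist)+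
      have "t / y - t' / y' = (t - t') / y + t' * (y' - y) / (y * y')"
        using nz by (simp add: field_simps)
      then have "\<bar>t / y - t' / y'\<bar> \<le> \<bar>t - t'\<bar> / \<bar>y\<bar> + \<bar>t'\<bar> * \<bar>y - y'\<bar> / (\<bar>y\<bar> * \<bar>y'\<bar>)"
        by (metis abs_divide abs_minus_commute abs_mult abs_triangle_ineq)
      also have "\<dots> \<le> ?d / m + T * ?d / (m * m)"
        using d n m T by (intro add_mono frac_le mult_mono) auto
      finally have quot: "\<bar>t / y - t' / y'\<bar> \<le> (1 / m + T / (m * m)) * ?d"
        by (simp add: distrib_right)
      have "\<bar>cone_fun p - cone_fun q\<bar> \<le> \<bar>2 * y - 2 * y'\<bar> + \<bar>2 * (t / y) - 2 * (t' / y')\<bar>"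
      proof (cases "0 < y0")
        case True
        then have "0 < y" "0 < y'" using n by auto
        then show ?thesis unfolding pq by (simp only: cone_clamp(1) abs_clamp_diff_le(1))
      next
        case False
        then have "y < 0" "y' < 0" using n nz by auto
        then show ?thesis unfolding pq by (simp only: cone_clamp(2) abs_clamp_diff_le(2))
      qed
      also have "\<dots> = 2 * \<bar>y - y'\<bar> + 2 * \<bar>t / y - t' / y'\<bar>"
        by (simp add: abs_if)
      also have "\<dots> \<le> 2 * ?d + 2 * ((1 / m + T / (m * m)) * ?d)"
        using d(1) quot by (intro add_mono mult_left_mono) auto
      also have "\<dots> = L * ?d" by (simp add: L_def algebra_simps)
      finally show "dist (cone_fun p) (cone_fun q) \<le> L * dist p q" by (simp add: dist_real_def)
    qed
    with m show ?thesis by blast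
  next
    case 2
    have "0-lipschitz_on (cball x (- t0 / 2) \<inter> (UNIV - {0})) cone_fun"
    proof (rule lipschitz_onI)
      fix p q assume "p \<in> cball x (- t0 / 2) \<inter> (UNIV - {0})" "q \<in> cball x (- t0 / 2) \<inter> (UNIV - {0})"
      moreover have "cone_fun z = 0" if "z \<in> cball x (- t0 / 2)" for z
      proof -
        have "\<bar>t0 - snd z\<bar> \<le> - t0 / 2"
          using dist(2)[of t0 "snd z" y0 "fst z"] that by (simp add: x)
        then have "snd z \<le> 0" using 2 by linarith
        then show ?thesis by (simp add: cone_fun_def slope_def)
      qed
      ultimately show "dist (cone_fun p) (cone_fun q) \<le> 0 * dist p q" by simp
    qed simp
    then show ?thesis using 2 by (intro exI[of _ "- t0 / 2"]) auto
  next
    case 3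
    \<comment> \<open>With \<open>u \<le> 1\<close> and \<open>u \<le> t0 / 2\<close>, points of the
      ball satisfy \<open>y\<^sup>2 \<le> u\<^sup>2 \<le> u \<le> t0 / 2 \<le> t\<close>, so the
      ball lies above the parabola.\<close>
    define u where "u = min 1 (t0 / 2)"
    have "2-lipschitz_on (cball x u \<inter> (UNIV - {0})) cone_fun"
    proof (rule lipschitz_onI)
      fix p q assume pq: "p \<in> cball x u \<inter> (UNIV - {0})" "q \<in> cball x u \<inter> (UNIV - {0})"
      have cone_fun: "cone_fun z = 2 * fst z" if "z \<in> cball x u" for z
      proof -
        have "\<bar>y0 - fst z\<bar> \<le> u" "\<bar>t0 - snd z\<bar> \<le> u"
          using dist[where y=y0 and t=t0 and y'="fst z" and t'="snd z"] that by (auto simp: x)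
        moreover have u: "0 \<le> u" "u \<le> 1" "u \<le> t0 / 2" using 3 by (auto simp: u_def)
        ultimately have z: "\<bar>fst z\<bar> \<le> u" "t0 / 2 \<le> snd z" using 3(1) by (simp, linarith)
        have "(fst z)\<^sup>2 \<le> u\<^sup>2" using z(1) u(1) by (metis abs_le_square_iff abs_of_nonneg)
        also have "\<dots> \<le> u * 1" unfolding power2_eq_square using u by (intro mult_left_mono) auto
        finally have "(fst z)\<^sup>2 \<le> snd z" using z u by linarith
        then show ?thesis using z(2) 3 by (simp add: cone_fun_def slope_def)
      qed
      have "\<bar>fst p - fst q\<bar> \<le> dist p q" using dist_fst_le[of p q] by (simp add: dist_real_def)
      then show "dist (cone_fun p) (cone_fun q) \<le> 2 * dist p q"
        using cone_fun[of p] cone_fun[of q] pq by (simp add: dist_real_def)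
    qed simp
    moreover have "u > 0" using 3 by (simp add: u_def)
    ultimately show ?thesis by blast
  qed
qed

section \<open>Intrinsic planes\<close>

lemma AE_lebesgue_imp_negligible:
  assumes "AE x in lebesgue. P x"
  shows "negligible {x. \<not> P x}"
proof -
  obtain N where "N \<in> null_sets lebesgue" "{x. \<not> P x} \<subseteq> N"
    using assms by (auto simp: eventually_ae_filter)
  then show ?thesis using negligible_iff_null_sets negligible_subset by blast
qed

lemma inv_heisenberg: "inv\<^bsub>heisenberg\<^esub> (x, y, z) = (- x, - y, - z)"
  by (rule group.inv_equality[OF group_heisenberg]) (auto simp: heisenberg_def)

text \<open>The quotient \<open>q\<inverse> q'\<close> of two points of the plane lies in the subgroup.  Since almost all points
  \<open>(0, y, t)\<close> with \<open>t < 0\<close> lie on the graph, these quotients exhaust the vertical subgroup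
  \<open>{x = 0}\<close>.\<close>

lemma intrinsic_plane_graph_constant:
  assumes ae: "AE x in lebesgue. snd x < 0 \<longrightarrow> g x = 0"
    and plane: "intrinsic_plane (intrinsic_graph UNIV g)"
  shows "\<exists>c. \<forall>x. g x = c"
proof -
  obtain W p1 p2 p3 where W: "subgroup W heisenberg"
    and graph: "intrinsic_graph UNIV g = (p1, p2, p3) <#\<^bsub>heisenberg\<^esub> W"
    using plane by (auto simp: intrinsic_plane_def lie_subgroup_2_def)
  have mult: "(x, y, z) \<otimes>\<^bsub>heisenberg\<^esub> (x', y', z') = (x + x', y + y', z + z' + (x * y' - x' * y) / 2)"
    for x y z x' y' z' :: real
    by (simp add: heisenberg_def)
  define N where "N = {x. \<not> (snd x < 0 \<longrightarrow> g x = 0)}"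
  have N: "negligible N" unfolding N_def by (rule AE_lebesgue_imp_negligible[OF ae])
  have vertical: "(0, v1, v2) \<in> W" for v1 v2
  proof -
    \<comment> \<open>For \<open>a\<close> in \<open>U\<close>, both \<open>a\<close> and its
      translate by \<open>(v1, v2)\<close> have negative second coordinate. As \<open>U\<close> is
      open and nonempty, \<open>a\<close> can be chosen so that neither of them falls into the null
      set \<open>N\<close>.\<close>
    define U where "U = {x :: real \<times> real. snd x < min 0 (- v2)}"
    have "open U" unfolding U_def by (intro open_Collect_less continuous_intros)
    moreover have "(0, min 0 (- v2) - 1) \<in> U" unfolding U_def by auto
    ultimately have "\<not> negligible U" using open_not_negligible by blast
    moreover have "negligible (N \<union> (+) (- (v1, v2)) ` N)"
      using N by (intro negligible_Un negligible_translation)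
    ultimately have "\<not> U \<subseteq> N \<union> (+) (- (v1, v2)) ` N" using negligible_subset by blast
    then obtain a where a: "snd a < min 0 (- v2)" "a \<notin> N" "a \<notin> (+) (- (v1, v2)) ` N"
      unfolding U_def by auto
    obtain a1 a2 where a12: "a = (a1, a2)" by force
    have "a + (v1, v2) \<notin> N" using a(3) by (metis add.commute add_uminus_conv_diff diff_add_cancel image_eqI)
    then have g0: "g (a1, a2) = 0" "g (a1 + v1, a2 + v2) = 0"
      using a by (auto simp: N_def a12)
    have "(0, a1, a2) \<in> intrinsic_graph UNIV g" "(0, a1 + v1, a2 + v2) \<in> intrinsic_graph UNIV g"
      unfolding intrinsic_graph_eq using g0 by force+
    then obtain w w' where w: "w \<in> W" "(0, a1, a2) = (p1, p2, p3) \<otimes>\<^bsub>heisenberg\<^esub> w"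
      and w': "w' \<in> W" "(0, a1 + v1, a2 + v2) = (p1, p2, p3) \<otimes>\<^bsub>heisenberg\<^esub> w'"
      unfolding graph l_coset_def by blast
    obtain w1 w2 w3 where w123: "w = (w1, w2, w3)" by (cases w)
    obtain w1' w2' w3' where w'123: "w' = (w1', w2', w3')" by (cases w')
    have "inv\<^bsub>heisenberg\<^esub> w \<otimes>\<^bsub>heisenberg\<^esub> w' \<in> W"
      using W w(1) w'(1) by (simp add: subgroup.m_closed subgroup.m_inv_closed)
    moreover have "inv\<^bsub>heisenberg\<^esub> w \<otimes>\<^bsub>heisenberg\<^esub> w' = (0, v1, v2)"
    proof -
      have e: "p1 = - w1" "w1' = w1" "w2' = w2 + v1"
        "p3 + w3 + (p1 * w2 - w1 * p2) / 2 = a2" "p3 + w3' + (p1 * w2' - w1' * p2) / 2 = a2 + v2"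
        using w(2) w'(2) by (auto simp: w123 w'123 mult)
      show ?thesis
        using e(4,5) by (simp add: w123 w'123 inv_heisenberg mult e(1-3) field_simps)
    qed
    ultimately show ?thesis by simp
  qed
  have "g (y, t) = p1" for y t
  proof -
    \<comment> \<open>The vertical element is found by solving the group law for the point of height
      \<open>p1\<close> over \<open>(y, t)\<close>. This point then lies on the graph, and its last
      two coordinates determine the base point, so \<open>g (y, t) = p1\<close>.\<close>
    have "(p1, p2, p3) \<otimes>\<^bsub>heisenberg\<^esub> (0, y - p2, t - y * p1 / 2 - p3 - p1 * (y - p2) / 2)
        \<in> intrinsic_graph UNIV g"
      unfolding graph l_coset_def using vertical by blast
    then have "(p1, y, t - y * p1 / 2) \<in> intrinsic_graph UNIV g"
      by (simp add: mult)
    then show ?thesis by (auto simp: intrinsic_graph_eq)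
  qed
  then show ?thesis by auto
qed

section \<open>First and second variation\<close>

lemma Ck_on_bounded_linear:
  assumes "bounded_linear l"
  shows "Ck_on k UNIV l"
proof (cases k)
  case 0
  then show ?thesis using linear_continuous_on[OF assms] by simp
next
  case (Suc n)
  have "(l has_derivative l) (at x)" for x by (rule bounded_linear_imp_has_derivative[OF assms])
  then have "frechet_derivative l (at x) e = l e" "l differentiable (at x)" for x e
    using frechet_derivative_eqI differentiableI by blast+
  then show ?thesis using Suc by (simp add: Ck_on_const)
qed

lemma test_function_smooth_mult:
  assumes g: "smooth_on UNIV g" and \<phi>: "\<phi> \<in> test_functions UNIV"
  shows "(\<lambda>x. g x * \<phi> x) \<in> test_functions UNIV"
proof -
  have "smooth_on UNIV (\<lambda>x. g x * \<phi> x)"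
    using g \<phi> by (simp add: smooth_on_def test_functions_def Ck_on_mult)
  moreover have "spt (\<lambda>x. g x * \<phi> x) \<subseteq> spt \<phi>"
    unfolding spt_def by (intro closure_mono) auto
  then have "compact (spt (\<lambda>x. g x * \<phi> x))"
    using test_function_compact_spt[OF \<phi>]
    by (metis bounded_subset closed_closure compact_eq_bounded_closed spt_def)
  ultimately show ?thesis by (simp add: test_functions_def)
qed

lemma fan_bounded_borel: "fan_bounded u \<Longrightarrow> u \<in> borel_measurable borel"
  by (simp add: fan_bounded_def)

lemma weak_partial_lborel:
  assumes w: "has_weak_partial UNIV e u v" and u: "fan_bounded u" and v: "fan_bounded v"
    and \<phi>: "\<phi> \<in> test_functions UNIV" and e: "e \<in> Basis"
  shows "(LINT x|lborel. u x * frechet_derivative \<phi> (at x) e) = - (LINT x|lborel. v x * \<phi> x)"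
proof -
  have [measurable]: "u \<in> borel_measurable borel" "v \<in> borel_measurable borel"
    "\<phi> \<in> borel_measurable borel" "(\<lambda>x. frechet_derivative \<phi> (at x) e) \<in> borel_measurable borel"
    using u v fan_bounded_borel test_function_borel[OF \<phi>]
      test_function_borel[OF test_function_partial[OF \<phi> e]] by auto
  have "(LINT x|lebesgue. u x * frechet_derivative \<phi> (at x) e) = (LINT x|lborel. u x * frechet_derivative \<phi> (at x) e)"
    "(LINT x|lebesgue. v x * \<phi> x) = (LINT x|lborel. v x * \<phi> x)"
    by (rule integral_completion; measurable)+
  then show ?thesis using has_weak_partialD(3)[OF w \<phi>] by simp
qed

section \<open>Expansion of the area of a perturbation\<close>

definition var1 :: "(real \<times> real \<Rightarrow> real) \<Rightarrow> real \<times> real \<Rightarrow> real" where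
  "var1 \<phi> x = D_y \<phi> x + cone_fun x * D_t \<phi> x + cone_t x * \<phi> x"

definition var2 :: "(real \<times> real \<Rightarrow> real) \<Rightarrow> real \<times> real \<Rightarrow> real" where
  "var2 \<phi> x = \<phi> x * D_t \<phi> x"

text \<open>The intrinsic gradient of \<open>cone_fun + \<epsilon> \<phi>\<close>. The operator is
  quadratic in the function, so the expansion in \<epsilon> is exact and has no remainder to
  estimate.\<close>

definition slope_pert :: "(real \<times> real \<Rightarrow> real) \<Rightarrow> real \<Rightarrow> real \<times> real \<Rightarrow> real" where
  "slope_pert \<phi> \<epsilon> x = slope x + \<epsilon> * var1 \<phi> x + \<epsilon>\<^sup>2 * var2 \<phi> x"

lemma slope_pert_0: "slope_pert \<phi> 0 x = slope x"
  by (simp add: slope_pert_def)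

context
  fixes \<phi> :: "real \<times> real \<Rightarrow> real"
  assumes \<phi>: "\<phi> \<in> test_functions UNIV"
begin

lemma locally_bounded_phi: "locally_bounded \<phi>" "locally_bounded (D_y \<phi>)" "locally_bounded (D_t \<phi>)"
  by (rule locally_bounded_test[OF \<phi>] locally_bounded_test[OF test_function_D_y[OF \<phi>]]
      locally_bounded_test[OF test_function_D_t[OF \<phi>]])+

lemma var_outside: "x \<notin> spt \<phi> \<Longrightarrow> var1 \<phi> x = 0" "x \<notin> spt \<phi> \<Longrightarrow> var2 \<phi> x = 0"
  by (simp_all add: var1_def var2_def not_in_spt test_function_partial_outside)

lemma locally_bounded_var2: "locally_bounded (var2 \<phi>)"
  unfolding var2_def[abs_def] by (intro locally_bounded_mult locally_bounded_phi)

lemma fan_bounded_var1: "fan_bounded (var1 \<phi>)"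
proof -
  have "fan_bounded (\<lambda>x. \<phi> x * cone_t x)"
    by (intro fan_bounded_mult locally_bounded_phi fan_bounded_cone_t)
  then have "fan_bounded (\<lambda>x. (D_y \<phi> x + cone_fun x * D_t \<phi> x) + cone_t x * \<phi> x)"
    by (intro fan_bounded_add fan_bounded_locally_bounded[OF locally_bounded_add]
        locally_bounded_mult locally_bounded_phi locally_bounded_cone) (simp add: mult.commute)
  then show ?thesis by (simp add: var1_def[abs_def])
qed

text \<open>\<open>fan_bounded\<close> is not closed under squaring, so the square is expanded: the
  mixed term is linear in \<open>cone_t\<close>, and the pure square is handled by
  \<open>cone_t_squared\<close>.\<close>

lemma fan_bounded_var1_squared: "fan_bounded (\<lambda>x. (var1 \<phi> x)\<^sup>2)"
proof -
  let ?X = "\<lambda>x. D_y \<phi> x + cone_fun x * D_t \<phi> x"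
  have X: "locally_bounded ?X"
    by (intro locally_bounded_add locally_bounded_mult locally_bounded_phi locally_bounded_cone)
  have "(var1 \<phi> x)\<^sup>2 = ?X x * ?X x + (2 * (?X x * \<phi> x) * cone_t x + 2 * (\<phi> x * \<phi> x) * slope_t x)" for x
  proof -
    have "(var1 \<phi> x)\<^sup>2 = ?X x * ?X x + (2 * (?X x * \<phi> x) * cone_t x + \<phi> x * \<phi> x * (cone_t x)\<^sup>2)"
      by (simp add: var1_def power2_eq_square algebra_simps)
    then show ?thesis by (simp add: cone_t_squared)
  qed
  moreover have "fan_bounded (\<lambda>x. ?X x * ?X x + (2 * (?X x * \<phi> x) * cone_t x + 2 * (\<phi> x * \<phi> x) * slope_t x))"
    by (intro fan_bounded_add fan_bounded_locally_bounded[OF locally_bounded_mult[OF X X]] fan_bounded_mult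
        locally_bounded_mult X locally_bounded_phi locally_bounded_const fan_bounded_cone_t fan_bounded_slope_t)
  ultimately show ?thesis by simp
qed

lemma perturbed_gradient:
  "AE x in lebesgue. intrinsic_gradient UNIV (\<lambda>x. cone_fun x + \<epsilon> * \<phi> x) x
    = slope_pert \<phi> \<epsilon> x"
proof -
  have "has_weak_partial UNIV (1, 0) (\<lambda>x. cone_fun x + \<epsilon> * \<phi> x) (\<lambda>x. cone_y x + \<epsilon> * D_y \<phi> x)"
    "has_weak_partial UNIV (0, 1) (\<lambda>x. cone_fun x + \<epsilon> * \<phi> x) (\<lambda>x. cone_t x + \<epsilon> * D_t \<phi> x)"
    by (intro has_weak_partial_add_cmult cone_weak_partials test_function_weak_partials[OF \<phi>];
        simp add: Basis_real2)+
  from this[THEN weak_partial_AE_eq] show ?thesis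
  proof eventually_elim
    case (elim x)
    have "cone_y x + \<epsilon> * D_y \<phi> x + (cone_fun x + \<epsilon> * \<phi> x) * (cone_t x + \<epsilon> * D_t \<phi> x)
        = (cone_y x + cone_fun x * cone_t x) + \<epsilon> * var1 \<phi> x + \<epsilon>\<^sup>2 * var2 \<phi> x"
      by (simp add: var1_def var2_def algebra_simps power2_eq_square)
    then show ?case unfolding intrinsic_gradient_def elim slope_gradient slope_pert_def .
  qed
qed

lemma fan_bounded_slope_pert: "fan_bounded (slope_pert \<phi> \<epsilon>)"
  unfolding slope_pert_def[abs_def]
  by (intro fan_bounded_add fan_bounded_locally_bounded[OF locally_bounded_slope]
      fan_bounded_locally_bounded[OF locally_bounded_var2]
      fan_bounded_mult[OF locally_bounded_const] fan_bounded_var1)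

lemma measurable_slope_pert [measurable]: "slope_pert \<phi> \<epsilon> \<in> borel_measurable borel"
  by (rule fan_bounded_borel[OF fan_bounded_slope_pert])

lemma measurable_spt [measurable]: "spt \<phi> \<in> sets borel"
  unfolding spt_def by (rule borel_closed) simp

lemma measurable_vars [measurable]:
  "var1 \<phi> \<in> borel_measurable borel" "var2 \<phi> \<in> borel_measurable borel"
  by (rule fan_bounded_borel fan_bounded_var1 fan_bounded_locally_bounded locally_bounded_var2)+

lemma slope_pert_deriv:
  "((\<lambda>\<epsilon>. slope_pert \<phi> \<epsilon> x) has_real_derivative var1 \<phi> x + 2 * \<epsilon> * var2 \<phi> x) (at \<epsilon>)"
  unfolding slope_pert_def by (auto intro!: derivative_eq_intros)

lemma area_density_integrable:
  "integrable lborel (\<lambda>x. indicator (spt \<phi>) x * sqrt (1 + (slope_pert \<phi> \<epsilon> x)\<^sup>2))"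
proof -
  have "locally_bounded (indicator (spt \<phi>) :: _ \<Rightarrow> real)"
    by (rule locally_boundedI[where C=1]) (auto split: split_indicator)
  then have "fan_bounded (\<lambda>x. indicator (spt \<phi>) x * (1 + \<bar>slope_pert \<phi> \<epsilon> x\<bar>))"
    by (intro fan_bounded_mult fan_bounded_add fan_bounded_abs fan_bounded_slope_pert
        fan_bounded_locally_bounded[OF locally_bounded_const])
  then have "integrable lborel (\<lambda>x. indicator (spt \<phi>) x * (1 + \<bar>slope_pert \<phi> \<epsilon> x\<bar>))"
    by (rule fan_bounded_integrable[OF _ \<phi>]) simp
  then show ?thesis
  proof (rule Bochner_Integration.integrable_bound)
    show "(\<lambda>x. indicator (spt \<phi>) x * sqrt (1 + (slope_pert \<phi> \<epsilon> x)\<^sup>2)) \<in> borel_measurable lborel"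
      by measurable
    have "sqrt (1 + a\<^sup>2) \<le> 1 + \<bar>a\<bar>" for a :: real
      by (rule real_le_lsqrt) (simp_all add: power2_eq_square algebra_simps)
    then show "AE x in lborel. norm (indicator (spt \<phi>) x * sqrt (1 + (slope_pert \<phi> \<epsilon> x)\<^sup>2))
        \<le> norm (indicator (spt \<phi>) x * (1 + \<bar>slope_pert \<phi> \<epsilon> x\<bar>))"
      by (intro AE_I2) (auto split: split_indicator)
  qed
qed

lemma perturbed_area_eq:
  "perturbed_area UNIV cone_fun \<phi> \<epsilon> =
    ennreal (LINT x|lborel. indicator (spt \<phi>) x * sqrt (1 + (slope_pert \<phi> \<epsilon> x)\<^sup>2))"
proof -
  have "perturbed_area UNIV cone_fun \<phi> \<epsilon> =
      (\<integral>\<^sup>+x. ennreal (indicator (spt \<phi>) x * sqrt (1 + (slope_pert \<phi> \<epsilon> x)\<^sup>2)) \<partial>lebesgue)"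
    unfolding perturbed_area_def graph_area_def
  proof (rule nn_integral_cong_AE)
    show "AE x in lebesgue. ennreal (sqrt (1 + (intrinsic_gradient UNIV (\<lambda>x. cone_fun x + \<epsilon> * \<phi> x) x)\<^sup>2))
        * indicator (spt \<phi>) x = ennreal (indicator (spt \<phi>) x * sqrt (1 + (slope_pert \<phi> \<epsilon> x)\<^sup>2))"
      using perturbed_gradient[of \<epsilon>] by eventually_elim (simp split: split_indicator)
  qed
  also have "\<dots> = (\<integral>\<^sup>+x. ennreal (indicator (spt \<phi>) x * sqrt (1 + (slope_pert \<phi> \<epsilon> x)\<^sup>2)) \<partial>lborel)"
    by (rule nn_integral_completion)
  also have "\<dots> = ennreal (LINT x|lborel. indicator (spt \<phi>) x * sqrt (1 + (slope_pert \<phi> \<epsilon> x)\<^sup>2))"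
    by (rule nn_integral_eq_integral[OF area_density_integrable]) simp
  finally show ?thesis .
qed

section \<open>Derivatives of the area in the perturbation parameter\<close>

definition area_deriv1 :: "real \<Rightarrow> real \<times> real \<Rightarrow> real" where
  "area_deriv1 \<epsilon> x = unit_slope (slope_pert \<phi> \<epsilon> x) * (var1 \<phi> x + 2 * \<epsilon> * var2 \<phi> x)"

definition area_deriv2 :: "real \<Rightarrow> real \<times> real \<Rightarrow> real" where
  "area_deriv2 \<epsilon> x = area_weight (slope_pert \<phi> \<epsilon> x) * (var1 \<phi> x + 2 * \<epsilon> * var2 \<phi> x)\<^sup>2
    + unit_slope (slope_pert \<phi> \<epsilon> x) * (2 * var2 \<phi> x)"

lemma measurable_area_derivs [measurable]:
  "area_deriv1 \<epsilon> \<in> borel_measurable borel" "area_deriv2 \<epsilon> \<in> borel_measurable borel"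
  unfolding area_deriv1_def[abs_def] area_deriv2_def[abs_def] by measurable

lemma abs_area_deriv1_le:
  assumes "\<bar>\<epsilon>\<bar> \<le> E"
  shows "\<bar>area_deriv1 \<epsilon> x\<bar> \<le> \<bar>var1 \<phi> x\<bar> + 2 * E * \<bar>var2 \<phi> x\<bar>"
proof -
  have "\<bar>area_deriv1 \<epsilon> x\<bar> \<le> 1 * \<bar>var1 \<phi> x + 2 * \<epsilon> * var2 \<phi> x\<bar>"
    unfolding area_deriv1_def abs_mult by (intro mult_right_mono abs_unit_slope_le) simp
  also have "\<dots> \<le> \<bar>var1 \<phi> x\<bar> + \<bar>2 * \<epsilon> * var2 \<phi> x\<bar>" by simp
  also have "\<bar>2 * \<epsilon> * var2 \<phi> x\<bar> \<le> 2 * E * \<bar>var2 \<phi> x\<bar>"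
    using assms by (simp add: abs_mult mult_right_mono)
  finally show ?thesis by simp
qed

text \<open>A majorant uniform in the parameter, from
  \<open>(a + b)\<^sup>2 \<le> 2 a\<^sup>2 + 2 b\<^sup>2\<close>; the constant 8 is twice the 4 from
  \<open>(2 * \<epsilon> * var2 \<phi> x)\<^sup>2\<close>.\<close>

lemma abs_area_deriv2_le:
  assumes "\<bar>\<epsilon>\<bar> \<le> E"
  shows "\<bar>area_deriv2 \<epsilon> x\<bar> \<le> 2 * (var1 \<phi> x)\<^sup>2 + 8 * E\<^sup>2 * (var2 \<phi> x)\<^sup>2 + 2 * \<bar>var2 \<phi> x\<bar>"
proof -
  let ?v = "var1 \<phi> x + 2 * \<epsilon> * var2 \<phi> x"
  have "\<bar>area_weight (slope_pert \<phi> \<epsilon> x) * ?v\<^sup>2\<bar> \<le> 1 * ?v\<^sup>2"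
    using area_weight_bounds[of "slope_pert \<phi> \<epsilon> x"] unfolding abs_mult by (intro mult_mono) auto
  also have "\<dots> \<le> 2 * (var1 \<phi> x)\<^sup>2 + 2 * (2 * \<epsilon> * var2 \<phi> x)\<^sup>2"
    using zero_le_power2[of "var1 \<phi> x - 2 * \<epsilon> * var2 \<phi> x"]
    by (simp add: power2_eq_square algebra_simps)
  also have "(2 * \<epsilon> * var2 \<phi> x)\<^sup>2 \<le> 4 * E\<^sup>2 * (var2 \<phi> x)\<^sup>2"
  proof -
    have "\<epsilon>\<^sup>2 \<le> E\<^sup>2" using assms by (metis abs_ge_zero order_trans power2_abs power_mono)
    then have "\<epsilon>\<^sup>2 * (var2 \<phi> x)\<^sup>2 \<le> E\<^sup>2 * (var2 \<phi> x)\<^sup>2" by (intro mult_right_mono) auto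
    then show ?thesis by (simp add: power_mult_distrib)
  qed
  finally have 1: "\<bar>area_weight (slope_pert \<phi> \<epsilon> x) * ?v\<^sup>2\<bar> \<le> 2 * (var1 \<phi> x)\<^sup>2 + 8 * E\<^sup>2 * (var2 \<phi> x)\<^sup>2"
    by simp
  have "\<bar>unit_slope (slope_pert \<phi> \<epsilon> x) * (2 * var2 \<phi> x)\<bar> \<le> 1 * \<bar>2 * var2 \<phi> x\<bar>"
    unfolding abs_mult[of "unit_slope _"] by (intro mult_right_mono abs_unit_slope_le) simp
  with 1 show ?thesis unfolding area_deriv2_def by (smt (verit) abs_mult abs_numeral)
qed

text \<open>This allows the indicator of the support to be dropped after one differentiation; only
  the undifferentiated density, equal to at least 1 everywhere, needs it.\<close>

lemma area_deriv1_outside: "x \<notin> spt \<phi> \<Longrightarrow> area_deriv1 \<epsilon> x = 0"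
  by (simp add: area_deriv1_def var_outside)

lemma area_has_deriv1:
  "((\<lambda>\<epsilon>. LINT x|lborel. indicator (spt \<phi>) x * sqrt (1 + (slope_pert \<phi> \<epsilon> x)\<^sup>2))
    has_real_derivative (LINT x|lborel. area_deriv1 \<epsilon> x)) (at \<epsilon>)"
proof (rule has_real_derivative_integral[OF area_density_integrable])
  \<comment> \<open>Bounds every parameter \<open>s\<close> with
    \<open>\<bar>s - \<epsilon>\<bar> < 1\<close>, the range in which domination is
    required.\<close>
  let ?E = "\<bar>\<epsilon>\<bar> + 1"
  show "((\<lambda>s. indicator (spt \<phi>) x * sqrt (1 + (slope_pert \<phi> s x)\<^sup>2)) has_real_derivative area_deriv1 s x) (at s)" for s x
  proof -
    have "((\<lambda>s. indicator (spt \<phi>) x * sqrt (1 + (slope_pert \<phi> s x)\<^sup>2)) has_real_derivative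
        indicator (spt \<phi>) x * area_deriv1 s x) (at s)"
      unfolding area_deriv1_def
      by (intro DERIV_cmult DERIV_chain2[OF area_deriv slope_pert_deriv])
    moreover have "indicator (spt \<phi>) x * area_deriv1 s x = area_deriv1 s x"
      using area_deriv1_outside[of x s] by (simp split: split_indicator)
    ultimately show ?thesis by simp
  qed
  have "fan_bounded (\<lambda>x. \<bar>var1 \<phi> x\<bar> + 2 * ?E * \<bar>var2 \<phi> x\<bar>)"
    by (intro fan_bounded_add fan_bounded_mult[OF locally_bounded_const] fan_bounded_abs
        fan_bounded_var1 fan_bounded_locally_bounded locally_bounded_var2)
  then show "integrable lborel (\<lambda>x. \<bar>var1 \<phi> x\<bar> + 2 * ?E * \<bar>var2 \<phi> x\<bar>)"
    by (rule fan_bounded_integrable[OF _ \<phi>]) (simp add: var_outside)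
  show "\<bar>area_deriv1 s x\<bar> \<le> \<bar>var1 \<phi> x\<bar> + 2 * ?E * \<bar>var2 \<phi> x\<bar>" if "\<bar>s - \<epsilon>\<bar> < 1" for s x
    using that by (intro abs_area_deriv1_le) linarith
qed simp

lemma area_deriv1_integrable: "integrable lborel (area_deriv1 \<epsilon>)"
proof -
  have "fan_bounded (\<lambda>x. \<bar>var1 \<phi> x\<bar> + 2 * \<bar>\<epsilon>\<bar> * \<bar>var2 \<phi> x\<bar>)"
    by (intro fan_bounded_add fan_bounded_mult[OF locally_bounded_const] fan_bounded_abs
        fan_bounded_var1 fan_bounded_locally_bounded locally_bounded_var2)
  then have "integrable lborel (\<lambda>x. \<bar>var1 \<phi> x\<bar> + 2 * \<bar>\<epsilon>\<bar> * \<bar>var2 \<phi> x\<bar>)"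
    by (rule fan_bounded_integrable[OF _ \<phi>]) (simp add: var_outside)
  then show ?thesis
  proof (rule Bochner_Integration.integrable_bound)
    show "AE x in lborel. norm (area_deriv1 \<epsilon> x) \<le> norm (\<bar>var1 \<phi> x\<bar> + 2 * \<bar>\<epsilon>\<bar> * \<bar>var2 \<phi> x\<bar>)"
      using abs_area_deriv1_le[of \<epsilon> "\<bar>\<epsilon>\<bar>"] by (intro AE_I2) (smt (verit) real_norm_def)
  qed simp
qed

text \<open>The majorant contains the square of \<open>var1 \<phi>\<close> and hence of
  \<open>cone_t\<close>: the second derivative is where local square integrability of the singular
  derivative is used.\<close>

lemma area_has_deriv2:
  "((\<lambda>\<epsilon>. LINT x|lborel. area_deriv1 \<epsilon> x) has_real_derivative (LINT x|lborel. area_deriv2 \<epsilon> x)) (at \<epsilon>)"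
proof (rule has_real_derivative_integral[OF area_deriv1_integrable])
  let ?E = "\<bar>\<epsilon>\<bar> + 1"
  let ?G = "\<lambda>x. 2 * (var1 \<phi> x)\<^sup>2 + 8 * ?E\<^sup>2 * (var2 \<phi> x)\<^sup>2 + 2 * \<bar>var2 \<phi> x\<bar>"
  show "((\<lambda>s. area_deriv1 s x) has_real_derivative area_deriv2 s x) (at s)" for s x
  proof -
    have "((\<lambda>s. var1 \<phi> x + 2 * s * var2 \<phi> x) has_real_derivative 2 * var2 \<phi> x) (at s)"
      by (auto intro!: derivative_eq_intros)
    from DERIV_mult[OF DERIV_chain2[OF unit_slope_deriv slope_pert_deriv[where x=x]] this]
    show ?thesis
      unfolding area_deriv1_def area_deriv2_def by (simp add: power2_eq_square algebra_simps)
  qed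
  have "fan_bounded ?G"
    unfolding power2_eq_square[of "var2 \<phi> _"]
    by (intro fan_bounded_add fan_bounded_mult[OF locally_bounded_const] fan_bounded_abs
        fan_bounded_var1_squared fan_bounded_locally_bounded locally_bounded_mult locally_bounded_var2)
  then show "integrable lborel ?G"
    by (rule fan_bounded_integrable[OF _ \<phi>]) (simp add: var_outside)
  show "\<bar>area_deriv2 s x\<bar> \<le> ?G x" if "\<bar>s - \<epsilon>\<bar> < 1" for s x
    using that by (intro abs_area_deriv2_le) linarith
qed simp

text \<open>The integrand is \<open>unit_normal * (D_y \<phi> + \<partial>\<^sub>t (cone_fun
  \<phi>))\<close>. Integrating the first term by parts gives the integral of
  \<open>cone_fun * unit_normal_t * \<phi>\<close>; the \<open>D_t \<phi>\<close> term gives its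
  negative, together with a term that cancels the one containing \<open>cone_t\<close>.\<close>

lemma first_variation_zero: "(LINT x|lborel. area_deriv1 0 x) = 0"
proof -
  have basis: "(1, 0) \<in> (Basis :: (real \<times> real) set)" "(0, 1) \<in> (Basis :: (real \<times> real) set)"
    by (simp_all add: Basis_real2)
  note N = fan_bounded_locally_bounded[OF locally_bounded_normal]
  have fb: "fan_bounded (\<lambda>x. unit_normal x * cone_fun x)" "fan_bounded (\<lambda>x. - (cone_fun x * unit_normal_t x))"
    "fan_bounded (\<lambda>x. unit_normal x * cone_t x)"
    "fan_bounded (\<lambda>x. cone_fun x * unit_normal_t x + unit_normal x * cone_t x)"
    using fan_bounded_mult[OF locally_bounded_const[of "-1"] fan_bounded_cone_normal_t]
    by (simp_all add: fan_bounded_locally_bounded locally_bounded_mult locally_bounded_normal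
        locally_bounded_cone fan_bounded_mult fan_bounded_cone_t fan_bounded_add fan_bounded_cone_normal_t)
  have int: "integrable lborel (\<lambda>x. u x * v x)"
    if "fan_bounded u" "locally_bounded v" "\<And>x. x \<notin> spt \<phi> \<Longrightarrow> v x = 0" for u v :: "real \<times> real \<Rightarrow> real"
    using fan_bounded_integrable[OF fan_bounded_mult[OF that(2,1)] \<phi>] that(3) by (simp add: mult.commute)
  have I: "integrable lborel (\<lambda>x. unit_normal x * D_y \<phi> x)"
    "integrable lborel (\<lambda>x. unit_normal x * cone_fun x * D_t \<phi> x)"
    "integrable lborel (\<lambda>x. unit_normal x * cone_t x * \<phi> x)"
    "integrable lborel (\<lambda>x. cone_fun x * unit_normal_t x * \<phi> x)"
    by (intro int N fb fan_bounded_cone_normal_t locally_bounded_phi; simp add: not_in_spt test_function_partial_outside)+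
  have y: "(LINT x|lborel. unit_normal x * D_y \<phi> x) = (LINT x|lborel. cone_fun x * unit_normal_t x * \<phi> x)"
    using weak_partial_lborel[OF normal_weak_partials(1) N fb(2) \<phi> basis(1)] by simp
  have t: "(LINT x|lborel. unit_normal x * cone_fun x * D_t \<phi> x)
      = - (LINT x|lborel. (cone_fun x * unit_normal_t x + unit_normal x * cone_t x) * \<phi> x)"
    by (rule weak_partial_lborel[OF normal_cone_weak_partial_t fb(1) fb(4) \<phi> basis(2)])
  have "(LINT x|lborel. area_deriv1 0 x) = (LINT x|lborel. unit_normal x * D_y \<phi> x
      + unit_normal x * cone_fun x * D_t \<phi> x + unit_normal x * cone_t x * \<phi> x)"
    by (rule Bochner_Integration.integral_cong)
      (simp_all add: area_deriv1_def slope_pert_0 unit_normal_def var1_def algebra_simps)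
  also have "\<dots> = 0" using I y t by (simp add: distrib_right)
  finally show ?thesis .
qed

text \<open>Since \<open>\<partial>\<^sub>y unit_normal = - cone_fun \<partial>\<^sub>t unit_normal\<close>, the integrand is the Jacobian of
  \<open>(q, unit_normal)\<close>.\<close>

lemma integral_normal_jacobian:
  assumes q: "q \<in> test_functions UNIV"
  shows "integrable lborel (\<lambda>x. unit_normal_t x * (D_y q x + cone_fun x * D_t q x))"
    "(LINT x|lborel. unit_normal_t x * (D_y q x + cone_fun x * D_t q x)) = 0"
proof -
  note qy = test_function_D_y[OF q] and qt = test_function_D_t[OF q]
  have basis: "(1, 0) \<in> (Basis :: (real \<times> real) set)" "(0, 1) \<in> (Basis :: (real \<times> real) set)"
    by (simp_all add: Basis_real2)
  note N = fan_bounded_locally_bounded[OF locally_bounded_normal]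
  have fb: "fan_bounded (\<lambda>x. - (cone_fun x * unit_normal_t x))"
    using fan_bounded_mult[OF locally_bounded_const[of "-1"] fan_bounded_cone_normal_t] by simp
  have "fan_bounded (\<lambda>x. D_y q x * unit_normal_t x)" "fan_bounded (\<lambda>x. D_t q x * (cone_fun x * unit_normal_t x))"
    by (intro fan_bounded_mult locally_bounded_test[OF qy] locally_bounded_test[OF qt]
        fan_bounded_normal_t locally_bounded_cone)+
  from this[THEN fan_bounded_integrable[OF _ q]]
  have I: "integrable lborel (\<lambda>x. D_y q x * unit_normal_t x)"
    "integrable lborel (\<lambda>x. D_t q x * (cone_fun x * unit_normal_t x))"
    by (simp_all add: test_function_partial_outside)
  have eq: "unit_normal_t x * (D_y q x + cone_fun x * D_t q x)
      = D_y q x * unit_normal_t x + D_t q x * (cone_fun x * unit_normal_t x)" for x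
    by (simp add: algebra_simps)
  show "integrable lborel (\<lambda>x. unit_normal_t x * (D_y q x + cone_fun x * D_t q x))"
    unfolding eq using I by (rule Bochner_Integration.integrable_add)
  \<comment> \<open>Each half becomes an integral of \<open>unit_normal\<close> against a mixed
    second derivative of \<open>q\<close>, with opposite signs; symmetry of the mixed derivatives
    cancels them.\<close>
  have "(LINT x|lborel. unit_normal_t x * D_y q x) = - (LINT x|lborel. unit_normal x * D_t (D_y q) x)"
    using weak_partial_lborel[OF normal_weak_partials(2) N fan_bounded_normal_t qy basis(2)] by simp
  moreover have "(LINT x|lborel. cone_fun x * unit_normal_t x * D_t q x) = (LINT x|lborel. unit_normal x * D_y (D_t q) x)"
    using weak_partial_lborel[OF normal_weak_partials(1) N fb qt basis(1)] by simp
  ultimately show "(LINT x|lborel. unit_normal_t x * (D_y q x + cone_fun x * D_t q x)) = 0"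
    using I unfolding eq by (simp add: test_function_mixed_partials[OF q] mult.commute)
qed

text \<open>On the fan, \<open>cone_t = 2 / y\<close> and \<open>slope_t = 2 / y\<^sup>2\<close>, and the difference of the two
  sides is the weighted square of the derivative of \<open>\<phi>\<close> along the characteristics.\<close>

lemma second_variation_density:
  defines "X \<equiv> \<lambda>x. D_y \<phi> x + cone_fun x * D_t \<phi> x"
  shows "unit_normal_t x * (\<phi> x * \<phi> x + 2 * fst x * \<phi> x * X x)
    \<le> area_weight (slope x) * (var1 \<phi> x)\<^sup>2 - unit_normal_t x * (\<phi> x * \<phi> x)"
proof (cases "x \<in> fan")
  case True
  then have y: "fst x \<noteq> 0" by (rule fan_fst_nonzero)
  \<comment> \<open>With \<open>var1 \<phi> = X + 2 \<phi> / y\<close>, the two subtracted terms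
    remove \<open>2 \<phi>\<^sup>2 / y\<^sup>2\<close> each, and the second one also the cross term
    \<open>4 \<phi> X / y\<close>.\<close>
  have "(var1 \<phi> x)\<^sup>2 - slope_t x * (\<phi> x * \<phi> x) - slope_t x * (\<phi> x * \<phi> x + 2 * fst x * \<phi> x * X x) = (X x)\<^sup>2"
    using True y by (simp add: var1_def X_def cone_t_def slope_t_def field_simps power2_eq_square)
  then have "slope_t x * (\<phi> x * \<phi> x + 2 * fst x * \<phi> x * X x) \<le> (var1 \<phi> x)\<^sup>2 - slope_t x * (\<phi> x * \<phi> x)"
    using zero_le_power2[of "X x"] by linarith
  from mult_left_mono[OF this area_weight_bounds(1)[of "slope x"]] show ?thesis
    by (simp add: unit_normal_t_def algebra_simps)
next
  case False
  \<comment> \<open>Off the fan \<open>slope_t\<close> vanishes, so the left side is 0 and the right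
    side is a weighted square.\<close>
  then show ?thesis
    using area_weight_bounds(1)[of "slope x"] by (simp add: unit_normal_t_def slope_t_def)
qed

text \<open>The chain climbs from the vanishing Jacobian integral to the second variation: the
  pointwise inequality comes first, and then the integration by parts is undone by means of
  \<open>2 \<phi> D_t \<phi> = D_t s\<close>.\<close>

lemma second_variation_nonneg: "0 \<le> (LINT x|lborel. area_deriv2 0 x)"
proof -
  define s where "s = (\<lambda>x. \<phi> x * \<phi> x)"
  \<comment> \<open>The derivative of \<open>q\<close> along characteristics is
    \<open>\<phi>\<^sup>2 + 2 y \<phi> X\<phi>\<close>, the factor on the left of
    \<open>second_variation_density\<close>.\<close>
  define q where "q = (\<lambda>x. fst x * s x)"
  have smooth: "smooth_on UNIV \<phi>" "smooth_on UNIV (fst :: real \<times> real \<Rightarrow> real)"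
    using \<phi> by (simp_all add: test_functions_def smooth_on_def Ck_on_bounded_linear bounded_linear_fst)
  have s: "s \<in> test_functions UNIV"
    unfolding s_def by (rule test_function_smooth_mult[OF smooth(1) \<phi>])
  have q: "q \<in> test_functions UNIV"
    unfolding q_def by (rule test_function_smooth_mult[OF smooth(2) s])
  have s_t: "D_t s x = 2 * var2 \<phi> x" for x
  proof -
    obtain y t where x: "x = (y, t)" by force
    have "((\<lambda>t. s (y, t)) has_real_derivative D_t \<phi> (y, t) * \<phi> (y, t) + D_t \<phi> (y, t) * \<phi> (y, t)) (at t)"
      unfolding s_def by (rule DERIV_mult[OF test_function_deriv_t[OF \<phi>] test_function_deriv_t[OF \<phi>]])
    from DERIV_unique[OF test_function_deriv_t[OF s] this] show ?thesis
      by (simp add: x var2_def)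
  qed
  have s_y: "((\<lambda>y. s (y, t)) has_real_derivative 2 * (\<phi> (y, t) * D_y \<phi> (y, t))) (at y)" for y t
    using DERIV_mult[OF test_function_deriv_y[OF \<phi>, of t y] test_function_deriv_y[OF \<phi>, of t y]]
    by (simp add: s_def mult.commute)
  have q_y: "D_y q x = \<phi> x * \<phi> x + 2 * fst x * \<phi> x * D_y \<phi> x" for x
  proof -
    obtain y t where x: "x = (y, t)" by force
    have "((\<lambda>y. q (y, t)) has_real_derivative 1 * s (y, t) + 2 * (\<phi> (y, t) * D_y \<phi> (y, t)) * y) (at y)"
      unfolding q_def fst_conv by (rule DERIV_mult[OF DERIV_ident s_y])
    from DERIV_unique[OF test_function_deriv_y[OF q] this] show ?thesis
      by (simp add: x s_def)
  qed
  have q_t: "D_t q x = 2 * fst x * \<phi> x * D_t \<phi> x" for x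
  proof -
    obtain y t where x: "x = (y, t)" by force
    have "((\<lambda>t. q (y, t)) has_real_derivative y * D_t s (y, t)) (at t)"
      unfolding q_def fst_conv by (rule DERIV_cmult[OF test_function_deriv_t[OF s]])
    from DERIV_unique[OF test_function_deriv_t[OF q] this] show ?thesis
      by (simp add: x s_t var2_def)
  qed
  note N = fan_bounded_locally_bounded[OF locally_bounded_normal]
  have 1: "integrable lborel (\<lambda>x. area_weight (slope x) * (var1 \<phi> x)\<^sup>2)"
    by (rule fan_bounded_integrable[OF fan_bounded_mult[OF locally_bounded_weight fan_bounded_var1_squared] \<phi>])
      (simp add: var_outside)
  have 2: "integrable lborel (\<lambda>x. unit_normal x * D_t s x)"
    using fan_bounded_locally_bounded[OF locally_bounded_mult[OF locally_bounded_normal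
          locally_bounded_test[OF test_function_D_t[OF s]]]] s
    by (rule fan_bounded_integrable) (simp add: test_function_partial_outside)
  have 3: "integrable lborel (\<lambda>x. s x * unit_normal_t x)"
    using fan_bounded_mult[OF locally_bounded_test[OF s] fan_bounded_normal_t] s
    by (rule fan_bounded_integrable) (simp add: not_in_spt)
  have "0 = (LINT x|lborel. unit_normal_t x * (D_y q x + cone_fun x * D_t q x))"
    using integral_normal_jacobian(2)[OF q] by simp
  also have "\<dots> \<le> (LINT x|lborel. area_weight (slope x) * (var1 \<phi> x)\<^sup>2 - s x * unit_normal_t x)"
  proof (rule integral_mono[OF integral_normal_jacobian(1)[OF q]])
    show "integrable lborel (\<lambda>x. area_weight (slope x) * (var1 \<phi> x)\<^sup>2 - s x * unit_normal_t x)"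
      using 1 3 by (rule Bochner_Integration.integrable_diff)
    have "D_y q x + cone_fun x * D_t q x = \<phi> x * \<phi> x + 2 * fst x * \<phi> x * (D_y \<phi> x + cone_fun x * D_t \<phi> x)" for x
      by (simp add: q_y q_t algebra_simps)
    then show "unit_normal_t x * (D_y q x + cone_fun x * D_t q x)
        \<le> area_weight (slope x) * (var1 \<phi> x)\<^sup>2 - s x * unit_normal_t x" for x
      using second_variation_density[of x] by (simp add: s_def mult.commute)
  qed
  also have "\<dots> = (LINT x|lborel. area_weight (slope x) * (var1 \<phi> x)\<^sup>2) - (LINT x|lborel. s x * unit_normal_t x)"
    using 1 3 by simp
  also have "(LINT x|lborel. s x * unit_normal_t x) = - (LINT x|lborel. unit_normal x * D_t s x)"
    using weak_partial_lborel[OF normal_weak_partials(2) N fan_bounded_normal_t s]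
    by (simp add: Basis_real2 mult.commute)
  also have "(LINT x|lborel. area_weight (slope x) * (var1 \<phi> x)\<^sup>2) - - (LINT x|lborel. unit_normal x * D_t s x)
      = (LINT x|lborel. area_weight (slope x) * (var1 \<phi> x)\<^sup>2 + unit_normal x * D_t s x)"
    using 1 2 by simp
  also have "\<dots> = (LINT x|lborel. area_deriv2 0 x)"
    by (simp add: area_deriv2_def slope_pert_0 unit_normal_def s_t)
  finally show ?thesis .
qed

section \<open>Stability, and exclusion of intrinsic planes\<close>

lemma perturbed_area_finite: "perturbed_area UNIV cone_fun \<phi> \<epsilon> < \<infinity>"
  by (simp add: perturbed_area_eq)

lemma perturbed_area_has_derivative:
  "((\<lambda>\<epsilon>. enn2real (perturbed_area UNIV cone_fun \<phi> \<epsilon>)) has_real_derivative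
    (LINT x|lborel. area_deriv1 \<epsilon> x)) (at \<epsilon>)"
proof -
  have "0 \<le> (LINT x|lborel. indicator (spt \<phi>) x * sqrt (1 + (slope_pert \<phi> \<epsilon> x)\<^sup>2))" for \<epsilon>
    by (rule Bochner_Integration.integral_nonneg) simp
  then show ?thesis using area_has_deriv1 by (simp add: perturbed_area_eq)
qed

lemma cone_first_variation: "has_first_variation UNIV cone_fun \<phi> 0"
  unfolding has_first_variation_def
  using perturbed_area_has_derivative[of 0] perturbed_area_finite first_variation_zero by simp

lemma cone_second_variation: "\<exists>v\<ge>0. has_second_variation UNIV cone_fun \<phi> v"
  unfolding has_second_variation_def
  using perturbed_area_has_derivative perturbed_area_finite area_has_deriv2[of 0] second_variation_nonneg
  by (intro exI[of _ "LINT x|lborel. area_deriv2 0 x"] conjI exI[of _ "\<lambda>\<epsilon>. LINT x|lborel. area_deriv1 \<epsilon> x"]) simp_all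

end

lemma stable_cone: "stable UNIV cone_fun"
  unfolding stable_def stationary_def
  using cone_W1p_loc[of 1] cone_first_variation cone_second_variation by simp

lemma AE_lebesgue_open_ex:
  assumes "AE x in lebesgue. P x" "open U" "U \<noteq> {}"
  obtains x where "x \<in> U" "P x"
proof -
  have "\<not> U \<subseteq> {x. \<not> P x}"
    using negligible_subset[OF AE_lebesgue_imp_negligible[OF assms(1)]] open_not_negligible[OF assms(2,3)]
    by blast
  then show ?thesis using that by blast
qed

text \<open>A representative is known only almost everywhere, so the constant value forced by a
  plane is compared with \<open>cone_fun\<close> on nonempty open sets rather than at chosen
  points.\<close>

lemma cone_not_intrinsic_plane:
  assumes ae: "AE x in lebesgue. g x = cone_fun x"
  shows "\<not> intrinsic_plane (intrinsic_graph UNIV g)"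
proof
  assume plane: "intrinsic_plane (intrinsic_graph UNIV g)"
  have "AE x in lebesgue. snd x < 0 \<longrightarrow> g x = 0"
    using ae by eventually_elim (simp add: cone_fun_def slope_def)
  from intrinsic_plane_graph_constant[OF this plane] obtain c where "\<And>x. g x = c" by blast
  with ae have c: "AE x in lebesgue. cone_fun x = c" by (auto simp: eq_commute)
  have "open {x :: real \<times> real. snd x < 0}"
    by (intro open_Collect_less continuous_intros)
  moreover have "(0, -1) \<in> {x :: real \<times> real. snd x < 0}" by simp
  ultimately obtain x where "snd x < 0" "cone_fun x = c" using AE_lebesgue_open_ex[OF c] by blast
  then have "c = 0" by (simp add: cone_fun_def slope_def)
  \<comment> \<open>Above the parabola with \<open>y > 0\<close> the function equals
    \<open>2 y > 0\<close>, which contradicts the constant 0 found below the axis.\<close>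
  have "open {x :: real \<times> real. 0 < fst x \<and> (fst x)\<^sup>2 < snd x}"
    by (intro open_Collect_conj open_Collect_less continuous_intros)
  moreover have "(1, 2) \<in> {x :: real \<times> real. 0 < fst x \<and> (fst x)\<^sup>2 < snd x}" by simp
  ultimately obtain z where z: "0 < fst z" "(fst z)\<^sup>2 < snd z" "cone_fun z = c"
    using AE_lebesgue_open_ex[OF c] by blast
  then have "0 < snd z" using zero_le_power2[of "fst z"] by linarith
  then have "cone_fun z = 2 * fst z" using z by (simp add: cone_fun_def slope_def)
  with z \<open>c = 0\<close> show False by simp
qed

theorem theorem1p3:
  "\<exists>f :: real \<times> real \<Rightarrow> real.
     locally_lipschitz_on (UNIV - {0}) f \<and>
     (\<forall>p::real. 1 \<le> p \<and> p < 3 \<longrightarrow> f \<in> W1p_loc UNIV p) \<and>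
     stable UNIV f \<and>
     (\<forall>g. (AE x in lebesgue. g x = f x) \<longrightarrow> \<not> intrinsic_plane (intrinsic_graph UNIV g))"
proof (intro exI[of _ cone_fun] conjI allI impI)
  show "locally_lipschitz_on (UNIV - {0}) cone_fun" by (rule locally_lipschitz_cone)
  show "cone_fun \<in> W1p_loc UNIV p" if "1 \<le> p \<and> p < 3" for p
    using that by (intro cone_W1p_loc) auto
  show "stable UNIV cone_fun" by (rule stable_cone)
  show "\<not> intrinsic_plane (intrinsic_graph UNIV g)" if "AE x in lebesgue. g x = cone_fun x" for g
    using that by (rule cone_not_intrinsic_plane)
qed

end
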